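(* Let $n\ge1$, $\alpha\in\mathbb{R}\setminus\pi\mathbb{Z}$, and define $$S_{\mathrm{dy}}^\alpha(f):=\Bigl(\sum_{k\in\mathbb{Z}}|D_k^\alpha(f)|^2\Bigr)^{1/2}.$$ Then for every $1<p<\infty$ there exists a constant $c_{p,n}>0$ such that for all $f\in L^p(\mathbb{R}^n)$, $$\frac1{c_{p,n}}\|f\|_{L^p(\mathbb{R}^n)}\le\|S_{\mathrm{dy}}^\alpha(f)\|_{L^p(\mathbb{R}^n)}\le c_{p,n}\|f\|_{L^p(\mathbb{R}^n)}.$$ The constant is the same as in the classical dyadic square-function theorem: any constant $c_{p,n}$ for which these two inequalities hold for all $f\in L^p(\mathbb{R}^n)$ with $D_k$ in place of $D_k^\alpha$ may be used.
   Context: $M_\alpha f(x)=e^{i\pi|x|^2\cot\alpha}f(x)$ and $M_\alpha^{-1}$ is multiplication by $e^{-i\pi|x|^2\cot\alpha}$. $E_k$ is the classical dyadic conditional expectation: $E_kg(x)$ is the average of $g$ over the dyadic cube of side length $2^{-k}$ containing $x$; $D_k:=E_k-E_{k-1}$. The twisted martingale difference operators are $D_k^\alpha:=M_\alpha^{-1}D_kM_\alpha$. *)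

theory Defs
  imports "HOL-Analysis.Analysis"
begin

section \<open>Lebesgue norms with values in $[0,\infty]$\<close>

text \<open>The square function is a sum of infinitely many nonnegative terms and may a priori be
  infinite, so norms are taken of \<^typ>\<open>ennreal\<close>-valued functions; a statement
  that such a norm is bounded then includes finiteness almost everywhere.\<close>

text \<open>Only meant for exponents \<open>a > 0\<close>.\<close>
definition ennreal_powr :: "ennreal \<Rightarrow> real \<Rightarrow> ennreal" where
  "ennreal_powr x a = (if x = \<infinity> then \<infinity> else ennreal (enn2real x powr a))"

definition Lp_norm :: "real \<Rightarrow> (real ^ 'n \<Rightarrow> ennreal) \<Rightarrow> ennreal" where
  "Lp_norm p g = ennreal_powr (\<integral>\<^sup>+ x. ennreal_powr (g x) p \<partial>lebesgue) (1 / p)"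

abbreviation cLp_norm :: "real \<Rightarrow> (real ^ 'n \<Rightarrow> complex) \<Rightarrow> ennreal" where
  "cLp_norm p f \<equiv> Lp_norm p (\<lambda>x. ennreal (cmod (f x)))"

definition Lp_space :: "real \<Rightarrow> (real ^ 'n \<Rightarrow> complex) set" where
  "Lp_space p = {f. f \<in> borel_measurable lebesgue \<and> cLp_norm p f < \<infinity>}"

section \<open>Dyadic martingale differences\<close>

text \<open>The half-open cube $\prod_i [m_i 2^{-k}, (m_i+1) 2^{-k})$.\<close>
definition dyadic_cube :: "int \<Rightarrow> int ^ 'n \<Rightarrow> (real ^ 'n) set" where
  "dyadic_cube k m =
     {y. \<forall>i. of_int (m $ i) * 2 powi (- k) \<le> y $ i \<and> y $ i < (of_int (m $ i) + 1) * 2 powi (- k)}"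

definition dyadic_cube_at :: "int \<Rightarrow> real ^ 'n \<Rightarrow> (real ^ 'n) set" where
  "dyadic_cube_at k x = dyadic_cube k (\<chi> i. \<lfloor>2 powi k * x $ i\<rfloor>)"

lemma mem_dyadic_cube_iff:
  fixes x :: "real ^ 'n"
  shows "x \<in> dyadic_cube k m \<longleftrightarrow> m = (\<chi> i. \<lfloor>2 powi k * x $ i\<rfloor>)"
proof -
  have "(of_int a * 2 powi (- k) \<le> t \<and> t < (of_int a + 1) * 2 powi (- k)) \<longleftrightarrow> a = \<lfloor>2 powi k * t\<rfloor>"
    for a :: int and t :: real
  proof -
    have "(0::real) < 2 powi k" by simp
    then have "(of_int a * 2 powi (- k) \<le> t \<and> t < (of_int a + 1) * 2 powi (- k)) \<longleftrightarrow>
      of_int a \<le> 2 powi k * t \<and> 2 powi k * t < of_int a + 1"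
      by (simp add: power_int_minus field_simps)
    also have "\<dots> \<longleftrightarrow> a = \<lfloor>2 powi k * t\<rfloor>"
      by (auto simp: floor_eq_iff eq_commute[of a])
    finally show ?thesis .
  qed
  then show ?thesis
    unfolding dyadic_cube_def by (simp add: vec_eq_iff)
qed

lemma in_dyadic_cube_at: "x \<in> dyadic_cube_at k x"
  by (simp add: mem_dyadic_cube_iff dyadic_cube_at_def)

definition dyadic_E :: "int \<Rightarrow> (real ^ 'n \<Rightarrow> complex) \<Rightarrow> real ^ 'n \<Rightarrow> complex" where
  "dyadic_E k g x =
     (LINT y:dyadic_cube_at k x|lebesgue. g y) /\<^sub>R measure lebesgue (dyadic_cube_at k x)"

definition dyadic_D :: "int \<Rightarrow> (real ^ 'n \<Rightarrow> complex) \<Rightarrow> real ^ 'n \<Rightarrow> complex" where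
  "dyadic_D k g x = dyadic_E k g x - dyadic_E (k - 1) g x"

section \<open>Twisting by the chirp\<close>

definition chirp_mult :: "real \<Rightarrow> (real ^ 'n \<Rightarrow> complex) \<Rightarrow> real ^ 'n \<Rightarrow> complex" where
  "chirp_mult \<alpha> f x = exp (\<i> * of_real (pi * (norm x)\<^sup>2 * cot \<alpha>)) * f x"

definition chirp_mult_inv :: "real \<Rightarrow> (real ^ 'n \<Rightarrow> complex) \<Rightarrow> real ^ 'n \<Rightarrow> complex" where
  "chirp_mult_inv \<alpha> f x = exp (- (\<i> * of_real (pi * (norm x)\<^sup>2 * cot \<alpha>))) * f x"

definition twisted_D :: "real \<Rightarrow> int \<Rightarrow> (real ^ 'n \<Rightarrow> complex) \<Rightarrow> real ^ 'n \<Rightarrow> complex" where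
  "twisted_D \<alpha> k f = chirp_mult_inv \<alpha> (dyadic_D k (chirp_mult \<alpha> f))"

section \<open>Square functions\<close>

definition square_function ::
  "(int \<Rightarrow> (real ^ 'n \<Rightarrow> complex) \<Rightarrow> real ^ 'n \<Rightarrow> complex) \<Rightarrow> (real ^ 'n \<Rightarrow> complex) \<Rightarrow> real ^ 'n \<Rightarrow> ennreal"
  where "square_function T f x =
    ennreal_powr (\<Sum>\<^sub>\<infinity>k\<in>UNIV. ennreal ((cmod (T k f x))\<^sup>2)) (1 / 2)"

abbreviation S_dy :: "real \<Rightarrow> (real ^ 'n \<Rightarrow> complex) \<Rightarrow> real ^ 'n \<Rightarrow> ennreal" where
  "S_dy \<alpha> \<equiv> square_function (twisted_D \<alpha>)"

abbreviation S_dy_classical :: "(real ^ 'n \<Rightarrow> complex) \<Rightarrow> real ^ 'n \<Rightarrow> ennreal" where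
  "S_dy_classical \<equiv> square_function dyadic_D"

end

theory Submission
  imports Defs
begin

text \<open>The chirp has modulus one and \<open>D_k\<^sup>\<alpha> = M_\<alpha>\<^sup>-\<^sup>1 D_k M_\<alpha>\<close>, so the twisted square function of \<open>f\<close> is the
  classical one of \<open>M_\<alpha> f\<close>, and everything reduces to the classical theorem.

  The upper bound in the classical theorem comes from a function \<open>U (x, q)\<close> with
  \<open>U (x + d, q + d\<^sup>2) \<le> U (x, q) + \<phi> (x, q) d\<close>: evaluated along (martingale, square sum) it is a
  supermartingale, because \<open>\<phi>\<close> is constant on the cubes on which \<open>d\<close> has mean zero, and
  \<open>q powr (p/2) \<le> U + C \<bar>x\<bar> powr p\<close>. The lower bound follows by duality: with
  \<open>u = E_n f - E_0 f\<close> and \<open>g = sgn u \<bar>u\<bar> powr (p - 1)\<close> one has \<open>\<integral> u g = \<Sum> \<integral> D_k f D_k g\<close>, and the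
  upper bound for the conjugate exponent controls the square function of \<open>g\<close>. Both estimates are
  proved on a single cube, where only finitely many values occur, and are summed over all cubes
  of one generation, which is then sent to \<open>-\<infinity>\<close>.\<close>

section \<open>Convexity inequalities for powers\<close>

text \<open>The obstacle is uniformity: every constant has to survive the summation over infinitely
  many cubes and the limits in both directions of the generation. A function of two real variables
  provides this, because its properties involve \<open>p\<close> alone. It takes two forms. For p
  \<le> 2 the power p/2 is concave and (q + x^2)^(p/2) has a controlled second-order error. For p >
  2 the increments of q^(p/2) contain q^(p/2-1) d^2, and U carries a term -A q^(p/2-1) x^2 to cancel
  it. In both cases -C |x|^p supplies the remaining convexity, so real and imaginary parts are
  treated separately. Duality is run inside a finite filtration because the dual function is bounded
  there, which makes the absorption of half of the integral of |u|^p legitimate. It sees only E_n f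
  - E_0 f, as the square sum ignores the initial average; that average vanishes in the limit because
  the volume of the cubes grows while the L^p norm stays fixed.\<close>

lemma tangent_le_of_mono_deriv:
  fixes h h' :: "real \<Rightarrow> real"
  assumes "\<And>t. (h has_real_derivative h' t) (at t)"
    and mono: "\<And>s t. \<bar>s\<bar> \<le> M \<Longrightarrow> \<bar>t\<bar> \<le> M \<Longrightarrow> s \<le> t \<Longrightarrow> h' s \<le> h' t"
    and "\<bar>x\<bar> \<le> M" "\<bar>y\<bar> \<le> M"
  shows "h x + h' x * (y - x) \<le> h y"
proof (cases x y rule: linorder_cases)
  case less
  then obtain z where z: "x < z" "z < y" "h y - h x = (y - x) * h' z"
    using MVT2[of x y h h'] assms(1) by blast
  have "h' x \<le> h' z" using z assms by (intro mono) auto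
  then have "(y - x) * h' x \<le> (y - x) * h' z" using less by (intro mult_left_mono) auto
  then show ?thesis using z by (simp add: algebra_simps)
next
  case greater
  then obtain z where z: "y < z" "z < x" "h x - h y = (x - y) * h' z"
    using MVT2[of y x h h'] assms(1) by blast
  have "h' z \<le> h' x" using z assms by (intro mono) auto
  then have "(x - y) * h' z \<le> (x - y) * h' x" using greater by (intro mult_left_mono) auto
  then show ?thesis using z by (simp add: algebra_simps)
qed auto

text \<open>The derivative of |x|^p; the factor \<open>sgn x\<close> keeps the formula valid at 0,
  where it gives 0.\<close>

definition dpowr :: "real \<Rightarrow> real \<Rightarrow> real" where
  "dpowr p x = p * (sgn x * \<bar>x\<bar> powr (p - 1))"

text \<open>At 0 the difference quotient has modulus |h|^(p-1), which tends to 0 since p > 1.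
  Elsewhere the sign is locally constant, so |t| = t sgn x near x.\<close>

lemma has_real_derivative_abs_powr:
  assumes "1 < p"
  shows "((\<lambda>t. \<bar>t\<bar> powr p) has_real_derivative dpowr p x) (at x)"
proof (cases "x = 0")
  case True
  have "((\<lambda>h::real. \<bar>h\<bar> powr (p - 1)) \<longlongrightarrow> \<bar>0\<bar> powr (p - 1)) (at 0)"
    using assms by (intro tendsto_powr' tendsto_intros) auto
  then have *: "((\<lambda>h::real. \<bar>h\<bar> powr (p - 1)) \<longlongrightarrow> 0) (at 0)" using assms by simp
  have "((\<lambda>h. (\<bar>0 + h\<bar> powr p - \<bar>0\<bar> powr p) / h) \<longlongrightarrow> 0) (at (0::real))"
  proof (rule Lim_null_comparison[OF _ *])
    show "\<forall>\<^sub>F h in at (0::real). norm ((\<bar>0 + h\<bar> powr p - \<bar>0\<bar> powr p) / h) \<le> \<bar>h\<bar> powr (p - 1)"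
      by (auto simp: eventually_at_filter powr_diff)
  qed
  then show ?thesis using True unfolding True DERIV_def by (simp add: dpowr_def)
next
  case False
  have "((\<lambda>t. (t * sgn x) powr p) has_real_derivative dpowr p x) (at x)"
    using False by (auto intro!: derivative_eq_intros simp: dpowr_def abs_sgn sgn_if)
  moreover have "\<forall>\<^sub>F t in nhds x. \<bar>t\<bar> powr p = (t * sgn x) powr p"
  proof -
    have "\<forall>\<^sub>F t in nhds x. sgn t = sgn x"
    proof (cases "x > 0")
      case True
      have "\<forall>\<^sub>F t in nhds x. t \<in> {0<..}" using True by (intro eventually_nhds_in_open) auto
      then show ?thesis by eventually_elim (use True in auto)
    next
      case f: False
      have "\<forall>\<^sub>F t in nhds x. t \<in> {..<0}" using f False by (intro eventually_nhds_in_open) auto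
      then show ?thesis by eventually_elim (use False f in auto)
    qed
    then show ?thesis by eventually_elim (auto simp: abs_sgn)
  qed
  ultimately show ?thesis by (subst DERIV_cong_ev[OF refl _ refl])
qed

text \<open>The hypothesis says that h(t) = |t|^p - c/2 t^2 has a monotone derivative on [0, M].
  This derivative is odd, hence monotone on [-M, M]. The tangent inequality for h is the claim,
  because the quadratic part misses its tangent by exactly c/2 (y - x)^2.\<close>

lemma abs_powr_taylor:
  fixes p c M x y :: real
  assumes "1 < p"
    and mono: "\<And>s t. 0 \<le> s \<Longrightarrow> s \<le> t \<Longrightarrow> t \<le> M \<Longrightarrow>
                 p * s powr (p - 1) - c * s \<le> p * t powr (p - 1) - c * t"
    and M: "\<bar>x\<bar> \<le> M" "\<bar>y\<bar> \<le> M"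
  shows "\<bar>x\<bar> powr p + dpowr p x * (y - x) + c / 2 * (y - x)\<^sup>2 \<le> \<bar>y\<bar> powr p"
proof -
  let ?g = "\<lambda>s. p * s powr (p - 1) - c * s"
  let ?h = "\<lambda>t. \<bar>t\<bar> powr p - c / 2 * t\<^sup>2"
  let ?h' = "\<lambda>t. dpowr p t - c * t"
  have pos: "?h' t = ?g t" if "0 \<le> t" for t
    using that assms by (cases "t = 0") (auto simp: dpowr_def)
  have neg: "?h' t = - ?g (- t)" if "t \<le> 0" for t
    using that assms by (cases "t = 0") (auto simp: dpowr_def)
  have "?h x + ?h' x * (y - x) \<le> ?h y"
  proof (rule tangent_le_of_mono_deriv[OF _ _ M])
    show "(?h has_real_derivative ?h' t) (at t)" for t
      by (rule derivative_eq_intros has_real_derivative_abs_powr assms refl | simp)+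
    show "?h' s \<le> ?h' t" if st: "\<bar>s\<bar> \<le> M" "\<bar>t\<bar> \<le> M" "s \<le> t" for s t
    proof -
      consider "0 \<le> s" | "t \<le> 0" | "s < 0" "0 < t" by linarith
      then show ?thesis
      proof cases
        case 1
        then show ?thesis using mono[of s t] st pos[of s] pos[of t] by auto
      next
        case 2
        then show ?thesis using mono[of "-t" "-s"] st neg[of s] neg[of t] by auto
      next
        case 3
        then show ?thesis using mono[of 0 "-s"] mono[of 0 t] st neg[of s] pos[of t] assms(1) by auto
      qed
    qed
  qed
  then show ?thesis by (simp add: power2_eq_square algebra_simps)
qed

lemma abs_powr_tangent:
  assumes "1 < p"
  shows "\<bar>x\<bar> powr p + dpowr p x * (y - x) \<le> \<bar>y\<bar> powr p"
  proof -
  have "p * s powr (p - 1) - 0 * s \<le> p * t powr (p - 1) - 0 * t" if "0 \<le> s" "s \<le> t" for s t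
    using that assms by (auto intro!: powr_mono2)
  from abs_powr_taylor[of p "max \<bar>x\<bar> \<bar>y\<bar>" 0 x y, OF assms this] show ?thesis by auto
qed

text \<open>The number p (p - 1) M^(p-2) is the smallest value of the second derivative p (p - 1)
  |t|^(p-2) on 0 < |t| \<le> M, the exponent p - 2 being nonpositive.\<close>

lemma abs_powr_tangent_quadratic:
  assumes "1 < p" "p \<le> 2" "0 < M" "\<bar>x\<bar> \<le> M" "\<bar>y\<bar> \<le> M"
  shows "\<bar>x\<bar> powr p + dpowr p x * (y - x) + p * (p - 1) / 2 * M powr (p - 2) * (y - x)\<^sup>2 \<le> \<bar>y\<bar> powr p"
proof -
  let ?c = "p * (p - 1) * M powr (p - 2)"
  have "p * s powr (p - 1) - ?c * s \<le> p * t powr (p - 1) - ?c * t"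
    if st: "0 \<le> s" "s \<le> t" "t \<le> M" for s t
  proof (cases "s = t")
    case False
    let ?g = "\<lambda>s. p * s powr (p - 1) - ?c * s"
    \<comment> \<open>The mean value theorem asks for differentiability only inside (s, t), so the
      endpoint s = 0, where the second derivative may blow up, is covered by continuity.\<close>
    have "\<exists>l z. s < z \<and> z < t \<and> (?g has_real_derivative l) (at z) \<and> ?g t - ?g s = (t - s) * l"
    proof (rule MVT)
      show "continuous_on {s..t} ?g"
        using st assms by (intro continuous_intros continuous_on_powr') auto
      show "?g differentiable at x" if "s < x" "x < t" for x
      proof -
        have "(?g has_real_derivative (p * ((p - 1) * x powr (p - 1 - 1)) - ?c)) (at x)"
          using that st by (auto intro!: derivative_eq_intros)
        then show ?thesis using real_differentiable_def by blast
      qed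
    qed (use False st in auto)
    then obtain l z where z: "s < z" "z < t" "(?g has_real_derivative l) (at z)" "?g t - ?g s = (t - s) * l"
      by blast
    have "(?g has_real_derivative (p * ((p - 1) * z powr (p - 1 - 1)) - ?c)) (at z)"
      using z st by (auto intro!: derivative_eq_intros)
    then have l: "l = p * (p - 1) * (z powr (p - 2) - M powr (p - 2))"
      using DERIV_unique[OF z(3)] by (auto simp: algebra_simps)
    have "M powr (p - 2) \<le> z powr (p - 2)" using z st assms by (intro powr_mono2') auto
    then have "0 \<le> l" unfolding l using assms by auto
    then have "0 \<le> ?g t - ?g s" unfolding z(4) using False st by simp
    then show ?thesis by simp
  qed auto
  from abs_powr_taylor[OF assms(1) this assms(4,5)] show ?thesis by (simp add: algebra_simps)
qed

section \<open>Sub- and superadditivity of powers, Clarkson's inequality and the Bellman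
  inequalities\<close>

lemma powr_superadditive:
  fixes a b r :: real
  assumes "1 \<le> r" "0 \<le> a" "0 \<le> b"
  shows "a powr r + b powr r \<le> (a + b) powr r"
proof (cases "a + b = 0")
  case False
  then have s: "0 < a + b" using assms by auto
  \<comment> \<open>Replacing the factor t^(r-1) by (a + b)^(r-1) makes the bound linear in t, so
    the bounds for a and b add up.\<close>
  have *: "t powr r \<le> t * (a + b) powr (r - 1)" if "0 \<le> t" "t \<le> a + b" for t
  proof (cases "t = 0")
    case False
    have "t powr r = t * t powr (r - 1)" using that False by (simp add: powr_diff)
    also have "\<dots> \<le> t * (a + b) powr (r - 1)" using that assms by (intro mult_left_mono powr_mono2) auto
    finally show ?thesis .
  qed auto
  have "a powr r + b powr r \<le> (a + b) * (a + b) powr (r - 1)"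
    using *[of a] *[of b] assms by (simp add: algebra_simps)
  also have "\<dots> = (a + b) powr r" using s by (simp add: powr_diff)
  finally show ?thesis .
next
  case True
  then have "a = 0" "b = 0" using assms by auto
  then show ?thesis by simp
qed

lemma powr_subadditive:
  fixes a b r :: real
  assumes "0 \<le> r" "r \<le> 1" "0 \<le> a" "0 \<le> b"
  shows "(a + b) powr r \<le> a powr r + b powr r"
proof (cases "a + b = 0")
  case False
  then have s: "0 < a + b" using assms by auto
  have *: "t * (a + b) powr (r - 1) \<le> t powr r" if "0 \<le> t" "t \<le> a + b" for t
  proof (cases "t = 0")
    case False
    have "t * (a + b) powr (r - 1) \<le> t * t powr (r - 1)"
      using that assms False by (intro mult_left_mono powr_mono2') auto
    also have "\<dots> = t powr r" using that False by (simp add: powr_diff)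
    finally show ?thesis .
  qed auto
  have "(a + b) powr r = (a + b) * (a + b) powr (r - 1)" using s by (simp add: powr_diff)
  also have "\<dots> \<le> a powr r + b powr r"
    using *[of a] *[of b] assms by (simp add: algebra_simps)
  finally show ?thesis .
next
  case True
  then have "a = 0" "b = 0" using assms by auto
  then show ?thesis by simp
qed

lemma powr_add_le:
  fixes a b r :: real
  assumes "0 \<le> r" "0 \<le> a" "0 \<le> b"
  shows "(a + b) powr r \<le> 2 powr r * (a powr r + b powr r)"
proof -
  have "(a + b) powr r \<le> (2 * max a b) powr r" using assms by (intro powr_mono2) auto
  also have "\<dots> = 2 powr r * max a b powr r" using assms by (simp add: powr_mult)
  also have "\<dots> \<le> 2 powr r * (a powr r + b powr r)"
    by (intro mult_left_mono) (auto simp: max_def)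
  finally show ?thesis .
qed

lemma abs_powr_eq_square_powr: "\<bar>x\<bar> powr p = (x\<^sup>2) powr (p / 2)" for x p :: real
proof (cases "x = 0")
  case False
  have "x\<^sup>2 = \<bar>x\<bar> powr 2" by simp
  then show ?thesis by (simp only: powr_powr) simp
qed auto

text \<open>Superadditivity of s^(p/2) on the two squares, the parallelogram identity, and midpoint
  convexity of s^(p/2). For p = 2 the claim is the parallelogram identity itself; it stands apart
  because the tangent inequality is stated for exponents above 1.\<close>

lemma abs_powr_clarkson:
  fixes a b p :: real
  assumes "2 \<le> p"
  shows "\<bar>(a + b) / 2\<bar> powr p + \<bar>(a - b) / 2\<bar> powr p \<le> (\<bar>a\<bar> powr p + \<bar>b\<bar> powr p) / 2"
proof (cases "p = 2")
  case True
  then show ?thesis by (simp add: power2_eq_square field_simps)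
next
  case False
  have "\<bar>(a + b) / 2\<bar> powr p + \<bar>(a - b) / 2\<bar> powr p \<le> (((a + b) / 2)\<^sup>2 + ((a - b) / 2)\<^sup>2) powr (p / 2)"
    unfolding abs_powr_eq_square_powr using assms by (intro powr_superadditive) auto
  also have "((a + b) / 2)\<^sup>2 + ((a - b) / 2)\<^sup>2 = (a\<^sup>2 + b\<^sup>2) / 2" by (simp add: power2_eq_square field_simps)
  also have "\<dots> powr (p / 2) \<le> ((a\<^sup>2) powr (p / 2) + (b\<^sup>2) powr (p / 2)) / 2"
    using abs_powr_tangent[of "p/2" "(a\<^sup>2 + b\<^sup>2) / 2" "a\<^sup>2"] abs_powr_tangent[of "p/2" "(a\<^sup>2 + b\<^sup>2) / 2" "b\<^sup>2"]
      assms False by (simp add: field_simps)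
  finally show ?thesis unfolding abs_powr_eq_square_powr .
qed

text \<open>The tangent inequality is applied at the midpoint of x and y. Clarkson's inequality then
  returns the jump as 2 |(y - x)/2|^p, which is the source of 2^(1-p).\<close>

lemma abs_powr_tangent_superquadratic:
  assumes "2 \<le> p"
  shows "\<bar>x\<bar> powr p + dpowr p x * (y - x) + 2 powr (1 - p) * \<bar>y - x\<bar> powr p \<le> \<bar>y\<bar> powr p"
proof -
  have "2 powr (1 - p) * \<bar>y - x\<bar> powr p = 2 * \<bar>(y - x) / 2\<bar> powr p"
    by (simp add: powr_divide powr_diff)
  moreover have "\<bar>x\<bar> powr p + dpowr p x * ((y + x) / 2 - x) \<le> \<bar>(y + x) / 2\<bar> powr p"
    using assms by (intro abs_powr_tangent) auto
  moreover have "dpowr p x * ((y + x) / 2 - x) = dpowr p x * (y - x) / 2"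
    by (simp add: field_simps)
  ultimately show ?thesis using abs_powr_clarkson[OF assms, of y x] by argo
qed

text \<open>For \<open>\<bar>d\<bar> \<le> \<bar>x\<bar>\<close> the concavity of \<open>t powr (p/2)\<close> reduces the claim to a quadratic term; for larger
  jumps both sides are compared with \<open>\<bar>d\<bar> powr p\<close>.\<close>
lemma bellman_le_2:
  fixes x d q p :: real
  assumes p: "1 < p" "p \<le> 2" and q: "0 \<le> q"
  defines "C \<equiv> 24 / (p - 1)"
  shows "(q + d\<^sup>2 + (x + d)\<^sup>2) powr (p / 2) - C * \<bar>x + d\<bar> powr p
    \<le> (q + x\<^sup>2) powr (p / 2) - C * \<bar>x\<bar> powr p
        + (p * (q + x\<^sup>2) powr (p / 2 - 1) * x - C * dpowr p x) * d"
proof -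
  define s where "s = q + x\<^sup>2"
  have s0: "0 \<le> s" using q by (simp add: s_def)
  have C0: "C > 0" using p by (simp add: C_def)
  have sq: "q + d\<^sup>2 + (x + d)\<^sup>2 = s + (2 * x * d + 2 * d\<^sup>2)"
    by (simp add: s_def power2_eq_square algebra_simps)
  have s1: "0 \<le> s + (2 * x * d + 2 * d\<^sup>2)" unfolding sq[symmetric] using q by auto
  have sx: "s powr (p / 2 - 1) \<le> \<bar>x\<bar> powr (p - 2)" if "x \<noteq> 0"
  proof -
    have "s powr (p / 2 - 1) \<le> (x\<^sup>2) powr (p / 2 - 1)"
      using that p q by (intro powr_mono2') (auto simp: s_def)
    also have "\<dots> = \<bar>x\<bar> powr (p - 2)" unfolding abs_powr_eq_square_powr by (simp add: diff_divide_distrib)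
    finally show ?thesis .
  qed
  have half: "1 / 2 \<le> 2 powr (p - 2)"
    using powr_mono[of "-1" "p - 2" "2::real"] p by (simp add: powr_minus_divide)
  \<comment> \<open>C is chosen to make this 12 p. Large jumps dictate it: they need (4 + p) |d|^p
    \<le> 6 p |d|^p, and passing from |d|^p to (2 |d|)^(p-2) d^2 costs another factor 2.\<close>
  have Cp: "C * (p * (p - 1) / 2) = 12 * p" using p by (simp add: C_def)
  have "(s + (2 * x * d + 2 * d\<^sup>2)) powr (p / 2) - s powr (p / 2) - p * s powr (p / 2 - 1) * x * d
    \<le> C * (\<bar>x + d\<bar> powr p - \<bar>x\<bar> powr p - dpowr p x * d)"
  proof (cases "d = 0")
    case d: False
    \<comment> \<open>M will be twice the larger of |x| and |d|, which bounds both |x| and |x +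
      d|.\<close>
    have quad: "C * (p * (p - 1) / 2 * M powr (p - 2) * d\<^sup>2) \<le> C * (\<bar>x + d\<bar> powr p - \<bar>x\<bar> powr p - dpowr p x * d)"
      if "0 < M" "\<bar>x\<bar> \<le> M" "\<bar>x + d\<bar> \<le> M" for M
      using abs_powr_tangent_quadratic[OF p that] C0 by (intro mult_left_mono) auto
    show ?thesis
    proof (cases "\<bar>d\<bar> \<le> \<bar>x\<bar>")
      case True
      then have x: "x \<noteq> 0" using d by auto
      have spos: "0 < s" using x q by (simp add: s_def add_nonneg_pos)
      have "(s + (2 * x * d + 2 * d\<^sup>2)) powr (p / 2) \<le> s powr (p / 2) + (p / 2) * s powr (p / 2 - 1) * (2 * x * d + 2 * d\<^sup>2)"
      proof (cases "p = 2")
        case True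
        then show ?thesis using spos s1 by (simp)
      next
        case False
        define t where "t = s + (2 * x * d + 2 * d\<^sup>2)"
        \<comment> \<open>The tangent of the concave power at s, read off from the weighted
          arithmetic-geometric mean inequality with weights p/2 and 1 - p/2.\<close>
        have "t powr (p / 2) * s powr (1 - p / 2) \<le> (p / 2) * t + (1 - p / 2) * s"
        proof (cases "t = 0")
          case False
          then show ?thesis using Youngs_inequality_0[of "p/2" "1 - p/2" t s] p s1 spos
            by (auto simp: t_def)
        qed (use p s0 in auto)
        then have "t powr (p / 2) * s powr (1 - p / 2) * s powr (p / 2 - 1) \<le> ((p / 2) * t + (1 - p / 2) * s) * s powr (p / 2 - 1)"
          by (intro mult_right_mono) auto
        also have "t powr (p / 2) * s powr (1 - p / 2) * s powr (p / 2 - 1) = t powr (p / 2)"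
          using spos by (simp add: mult.assoc flip: powr_add)
        also have "((p / 2) * t + (1 - p / 2) * s) * s powr (p / 2 - 1) = s * s powr (p / 2 - 1) + (p / 2) * s powr (p / 2 - 1) * (t - s)"
          by (simp add: algebra_simps diff_divide_distrib add_divide_distrib)
        also have "s * s powr (p / 2 - 1) = s powr (p / 2)" using spos by (simp add: powr_diff)
        finally show ?thesis by (simp add: t_def)
      qed
      then have "(s + (2 * x * d + 2 * d\<^sup>2)) powr (p / 2) - s powr (p / 2) - p * s powr (p / 2 - 1) * x * d
        \<le> p * d\<^sup>2 * s powr (p / 2 - 1)" by (simp add: algebra_simps)
      also have "\<dots> \<le> p * d\<^sup>2 * \<bar>x\<bar> powr (p - 2)" using sx[OF x] p by (intro mult_left_mono) auto
      also have "\<dots> \<le> p * d\<^sup>2 * (2 * (2 powr (p - 2) * \<bar>x\<bar> powr (p - 2)))"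
        using half p mult_right_mono[OF half, of "\<bar>x\<bar> powr (p - 2)"] by (intro mult_left_mono) auto
      also have "\<dots> = p * d\<^sup>2 * (2 * (2 * \<bar>x\<bar>) powr (p - 2))" by (simp add: powr_mult)
      also have "\<dots> \<le> 12 * p * ((2 * \<bar>x\<bar>) powr (p - 2) * d\<^sup>2)" using p by simp
      also have "\<dots> = C * (p * (p - 1) / 2 * (2 * \<bar>x\<bar>) powr (p - 2) * d\<^sup>2)" unfolding Cp[symmetric] by (simp only: mult.assoc)
      also have "\<dots> \<le> C * (\<bar>x + d\<bar> powr p - \<bar>x\<bar> powr p - dpowr p x * d)"
        using True x by (intro quad) auto
      finally show ?thesis .
    next
      case False
      have "2 * x * d \<le> 2 * (\<bar>d\<bar> * \<bar>d\<bar>)"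
      proof -
        have "x * d \<le> \<bar>x\<bar> * \<bar>d\<bar>" by (metis abs_ge_self abs_mult)
        also have "\<dots> \<le> \<bar>d\<bar> * \<bar>d\<bar>" using False by (intro mult_right_mono) auto
        finally show ?thesis by simp
      qed
      then have "s + (2 * x * d + 2 * d\<^sup>2) \<le> s + (2 * d)\<^sup>2" by (simp add: power2_eq_square)
      then have "(s + (2 * x * d + 2 * d\<^sup>2)) powr (p / 2) \<le> (s + (2 * d)\<^sup>2) powr (p / 2)"
        using p s1 by (intro powr_mono2) auto
      also have "\<dots> \<le> s powr (p / 2) + ((2 * d)\<^sup>2) powr (p / 2)" using p s0 by (intro powr_subadditive) auto
      also have "((2 * d)\<^sup>2) powr (p / 2) = (2 powr p) * \<bar>d\<bar> powr p"
        unfolding abs_powr_eq_square_powr[symmetric] by (simp add: abs_mult powr_mult)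
      also have "\<dots> \<le> 4 * \<bar>d\<bar> powr p"
        using powr_mono[of p 2 "2::real"] p by (intro mult_right_mono) auto
      finally have 1: "(s + (2 * x * d + 2 * d\<^sup>2)) powr (p / 2) \<le> s powr (p / 2) + 4 * \<bar>d\<bar> powr p" by simp
      \<comment> \<open>Here the first-order term is estimated by its modulus: s^(p/2-1) |x| \<le>
        |x|^(p-1) \<le> |d|^(p-1).\<close>
      have 2: "- (p * s powr (p / 2 - 1) * x * d) \<le> p * \<bar>d\<bar> powr p"
      proof (cases "x = 0")
        case x: False
        have "- (s powr (p / 2 - 1) * x * d) \<le> s powr (p / 2 - 1) * \<bar>x\<bar> * \<bar>d\<bar>"
          by (metis abs_ge_minus_self abs_mult abs_of_nonneg powr_ge_zero)
        also have "\<dots> \<le> \<bar>x\<bar> powr (p - 2) * \<bar>x\<bar> * \<bar>d\<bar>" using sx[OF x] by (intro mult_right_mono) auto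
        also have "\<dots> = \<bar>x\<bar> powr (p - 1) * \<bar>d\<bar>" using x powr_add[of "\<bar>x\<bar>" "p - 2" 1] by simp
        also have "\<dots> \<le> \<bar>d\<bar> powr (p - 1) * \<bar>d\<bar>" using False p by (intro mult_right_mono powr_mono2) auto
        also have "\<dots> = \<bar>d\<bar> powr p" using d powr_add[of "\<bar>d\<bar>" "p - 1" 1] by simp
        finally have "p * - (s powr (p / 2 - 1) * x * d) \<le> p * \<bar>d\<bar> powr p" using p by (intro mult_left_mono) auto
        then show ?thesis by (simp add: mult.assoc)
      qed (use p in auto)
      have "\<bar>d\<bar> powr p = \<bar>d\<bar> powr (p - 2) * d\<^sup>2"
        using d powr_add[of "\<bar>d\<bar>" "p - 2" 2] by simp
      moreover have "1 / 2 * \<bar>d\<bar> powr (p - 2) \<le> (2 * \<bar>d\<bar>) powr (p - 2)"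
        using mult_right_mono[OF half, of "\<bar>d\<bar> powr (p - 2)"] by (simp add: powr_mult)
      then have "\<bar>d\<bar> powr (p - 2) * d\<^sup>2 \<le> (2 * (2 * \<bar>d\<bar>) powr (p - 2)) * d\<^sup>2"
        by (intro mult_right_mono) auto
      ultimately have 3: "\<bar>d\<bar> powr p \<le> 2 * ((2 * \<bar>d\<bar>) powr (p - 2) * d\<^sup>2)"
        by (simp only: mult.assoc)
      have "(s + (2 * x * d + 2 * d\<^sup>2)) powr (p / 2) - s powr (p / 2) - p * s powr (p / 2 - 1) * x * d \<le> (4 + p) * \<bar>d\<bar> powr p"
        using 1 2 by (simp add: algebra_simps)
      also have "\<dots> \<le> (6 * p) * (2 * ((2 * \<bar>d\<bar>) powr (p - 2) * d\<^sup>2))"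
        using p 3 by (intro mult_mono) auto
      also have "\<dots> = 12 * p * ((2 * \<bar>d\<bar>) powr (p - 2) * d\<^sup>2)" by simp
      also have "\<dots> = C * (p * (p - 1) / 2 * (2 * \<bar>d\<bar>) powr (p - 2) * d\<^sup>2)" unfolding Cp[symmetric] by (simp only: mult.assoc)
      also have "\<dots> \<le> C * (\<bar>x + d\<bar> powr p - \<bar>x\<bar> powr p - dpowr p x * d)"
        using False d by (intro quad) auto
      finally show ?thesis .
    qed
  qed auto
  then show ?thesis unfolding sq by (simp add: s_def algebra_simps)
qed

text \<open>The increment of q^(p/2) is at most A q^r d^2 + A |d|^p. The first term is the
  second-order part of A q^r x^2, and raising q to q + d^2 in that subtracted term only helps. The
  second is paid for by C |x|^p, whose tangent error is at least C 2^(1-p) |d|^p; hence the value of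
  C.\<close>

lemma bellman_gt_2:
  fixes x d q p :: real
  assumes p: "2 < p" and q: "0 \<le> q"
  defines "r \<equiv> p / 2 - 1"
  defines "A \<equiv> p / 2 * 2 powr r"
  defines "C \<equiv> A * 2 powr (p - 1)"
  shows "(q + d\<^sup>2) powr (p / 2) - A * (q + d\<^sup>2) powr r * (x + d)\<^sup>2 - C * \<bar>x + d\<bar> powr p
    \<le> q powr (p / 2) - A * q powr r * x\<^sup>2 - C * \<bar>x\<bar> powr p
        + (- 2 * A * q powr r * x - C * dpowr p x) * d"
proof -
  have r: "0 < r" using p by (simp add: r_def)
  have A: "0 < A" using p by (simp add: A_def)
  have C: "0 < C" using A by (simp add: C_def)
  have CA: "C * 2 powr (1 - p) = A" by (simp add: C_def mult.assoc flip: powr_add)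
  have "C * (2 powr (1 - p) * \<bar>d\<bar> powr p) \<le> C * (\<bar>x + d\<bar> powr p - \<bar>x\<bar> powr p - dpowr p x * d)"
    using abs_powr_tangent_superquadratic[of p x "x + d"] p C by (intro mult_left_mono) auto
  then have 1: "A * \<bar>d\<bar> powr p \<le> C * (\<bar>x + d\<bar> powr p - \<bar>x\<bar> powr p - dpowr p x * d)"
    using CA by (simp add: mult.assoc[symmetric])
  have "(q + d\<^sup>2) powr (p / 2) - q powr (p / 2) \<le> (p / 2) * (q + d\<^sup>2) powr r * d\<^sup>2"
  proof (cases "q + d\<^sup>2 = 0")
    case False
    then have "0 < q + d\<^sup>2" using q by (simp add: add_nonneg_eq_0_iff order_less_le)
    then show ?thesis using abs_powr_tangent[of "p/2" "q + d\<^sup>2" q] p q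
      by (simp add: dpowr_def r_def algebra_simps)
  qed (use q in \<open>auto simp: add_nonneg_eq_0_iff\<close>)
  also have "\<dots> \<le> (p / 2) * (2 powr r * (q powr r + (d\<^sup>2) powr r)) * d\<^sup>2"
    using p q r by (intro mult_right_mono mult_left_mono powr_add_le) auto
  also have "\<dots> = A * (q powr r * d\<^sup>2 + (d\<^sup>2) powr r * d\<^sup>2)" by (simp add: A_def algebra_simps)
  also have "(d\<^sup>2) powr r * d\<^sup>2 = \<bar>d\<bar> powr p"
    unfolding abs_powr_eq_square_powr using powr_add[of "d\<^sup>2" r 1] by (cases "d = 0") (auto simp: r_def)
  finally have 2: "(q + d\<^sup>2) powr (p / 2) - q powr (p / 2) \<le> A * (q powr r * d\<^sup>2) + A * \<bar>d\<bar> powr p"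
    by (simp add: algebra_simps)
  have "q powr r * (x + d)\<^sup>2 \<le> (q + d\<^sup>2) powr r * (x + d)\<^sup>2"
    using r q by (intro mult_right_mono powr_mono2) auto
  then have 3: "A * (q powr r * (x + d)\<^sup>2) \<le> A * ((q + d\<^sup>2) powr r * (x + d)\<^sup>2)"
    using A by (intro mult_left_mono) auto
  have 4: "A * (q powr r * (x + d)\<^sup>2) = A * (q powr r * x\<^sup>2) + 2 * A * (q powr r * x) * d + A * (q powr r * d\<^sup>2)"
    by (simp add: power2_eq_square algebra_simps)
  show ?thesis using 1 2 3 4 by (simp add: algebra_simps)
qed

text \<open>If A x^2 \<le> q/2, the mixed term uses up at most half of q^(p/2). Otherwise q < 2 A
  x^2, and the mixed term is at most a constant times |x|^p.\<close>

lemma bellman_majorant_gt_2: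
  fixes x q p :: real
  assumes p: "2 < p" and q: "0 \<le> q"
  defines "r \<equiv> p / 2 - 1"
  defines "A \<equiv> p / 2 * 2 powr r"
  defines "C \<equiv> A * 2 powr (p - 1)"
  shows "q powr (p / 2) / 2 - (A * (2 * A) powr r + C) * \<bar>x\<bar> powr p
    \<le> q powr (p / 2) - A * q powr r * x\<^sup>2 - C * \<bar>x\<bar> powr p"
proof -
  have r: "0 < r" using p by (simp add: r_def)
  have A: "0 < A" using p by (simp add: A_def)
  have e: "t * t powr r = t powr (p / 2)" if "0 \<le> t" for t :: real
    using that by (cases "t = 0") (auto simp: r_def powr_diff)
  have "A * q powr r * x\<^sup>2 \<le> q powr (p / 2) / 2 + A * (2 * A) powr r * \<bar>x\<bar> powr p"
  proof (cases "A * x\<^sup>2 \<le> q / 2")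
    case True
    have "A * q powr r * x\<^sup>2 = (A * x\<^sup>2) * q powr r" by simp
    also have "\<dots> \<le> (q / 2) * q powr r" using True by (intro mult_right_mono) auto
    also have "\<dots> = q powr (p / 2) / 2" using e[OF q] by simp
    finally show ?thesis using A by (smt (verit) mult_nonneg_nonneg powr_ge_zero)
  next
    case False
    have "A * q powr r * x\<^sup>2 \<le> A * (2 * A * x\<^sup>2) powr r * x\<^sup>2"
      using False A q r by (intro mult_right_mono mult_left_mono powr_mono2) auto
    also have "\<dots> = A * (2 * A) powr r * (x\<^sup>2 * (x\<^sup>2) powr r)" using A by (simp add: powr_mult)
    also have "x\<^sup>2 * (x\<^sup>2) powr r = \<bar>x\<bar> powr p" unfolding abs_powr_eq_square_powr by (intro e) auto
    finally show ?thesis using powr_ge_zero[of q "p / 2"] by linarith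
  qed
  then show ?thesis by (simp add: algebra_simps)
qed

section \<open>Square functions for finite filtrations\<close>

text \<open>\<open>U x 0 \<le> 0\<close> is the initial value, the square sum being empty at time 0.
  The slope \<open>\<phi>\<close> may be any function of the state before the jump, which is what
  makes it constant on the atoms of the current generation.\<close>

definition bellman :: "real \<Rightarrow> real \<Rightarrow> (real \<Rightarrow> real \<Rightarrow> real) \<Rightarrow> (real \<Rightarrow> real \<Rightarrow> real) \<Rightarrow> bool" where
  "bellman p C U \<phi> \<longleftrightarrow> 0 < C \<and>
    (\<forall>x d q. 0 \<le> q \<longrightarrow> U (x + d) (q + d\<^sup>2) \<le> U x q + \<phi> x q * d) \<and>
    (\<forall>x. U x 0 \<le> 0) \<and> (\<forall>x q. 0 \<le> q \<longrightarrow> q powr (p / 2) \<le> U x q + C * \<bar>x\<bar> powr p)"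

lemma bellman_function_exists:
  fixes p :: real
  assumes p: "1 < p"
  shows "\<exists>C U \<phi>. bellman p C U \<phi>"
proof (cases "p \<le> 2")
  case True
  define C where "C = 24 / (p - 1)"
  \<comment> \<open>Needed for the initial value, as U x 0 = (1 - C) |x|^p.\<close>
  have C1: "1 \<le> C" using p True by (simp add: C_def field_simps)
  define U where "U = (\<lambda>x q. (q + x\<^sup>2) powr (p / 2) - C * \<bar>x\<bar> powr p)"
  show ?thesis
    unfolding bellman_def
  proof (intro exI conjI allI impI)
    show "0 < C" using C1 by simp
    show "U (x + d) (q + d\<^sup>2) \<le> U x q + (\<lambda>x q. p * (q + x\<^sup>2) powr (p / 2 - 1) * x - C * dpowr p x) x q * d"
      if "0 \<le> q" for x d q
      unfolding U_def C_def by (rule bellman_le_2[OF p True that])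
    show "U x 0 \<le> 0" for x
      using mult_right_mono[OF C1, of "\<bar>x\<bar> powr p"] by (simp add: U_def abs_powr_eq_square_powr)
    show "q powr (p / 2) \<le> U x q + C * \<bar>x\<bar> powr p" if "0 \<le> q" for x q
      using p that by (auto simp: U_def intro!: powr_mono2)
  qed
next
  case False
  then have p2: "2 < p" by simp
  define r where "r = p / 2 - 1"
  define A where "A = p / 2 * 2 powr r"
  define C where "C = A * 2 powr (p - 1)"
  define K where "K = A * (2 * A) powr r + C"
  have A: "0 < A" using p by (simp add: A_def)
  have K: "0 < K" using A by (simp add: K_def C_def add_nonneg_pos)
  define U where "U = (\<lambda>x q. q powr (p / 2) - A * q powr r * x\<^sup>2 - C * \<bar>x\<bar> powr p)"
  show ?thesis
    unfolding bellman_def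
  proof (intro exI conjI allI impI)
    \<comment> \<open>Doubling U undoes the factor 1/2 in the majorant; the other conditions are
      preserved by scaling.\<close>
    show "0 < 2 * K" using K by simp
    show "(\<lambda>x q. 2 * U x q) (x + d) (q + d\<^sup>2) \<le> (\<lambda>x q. 2 * U x q) x q
      + (\<lambda>x q. 2 * (- 2 * A * q powr r * x - C * dpowr p x)) x q * d"
      if "0 \<le> q" for x d q
      using bellman_gt_2[OF p2 that, of d x, folded r_def, folded A_def, folded C_def]
      unfolding U_def by argo
    show "2 * U x 0 \<le> 0" for x
      using A by (simp add: U_def C_def)
    show "q powr (p / 2) \<le> 2 * U x q + 2 * K * \<bar>x\<bar> powr p" if "0 \<le> q" for x q
      using bellman_majorant_gt_2[OF p2 that, of x, folded r_def, folded A_def, folded C_def, folded K_def]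
      unfolding U_def by argo
  qed
qed

text \<open>The constant depends on \<open>p\<close> only, hence is the same for all filtrations.\<close>
definition sq_const :: "real \<Rightarrow> real" where
  "sq_const p = (SOME C. \<exists>U \<phi>. bellman p C U \<phi>)"

lemma sq_const: "1 < p \<Longrightarrow> \<exists>U \<phi>. bellman p (sq_const p) U \<phi>"
  unfolding sq_const_def by (rule someI_ex[OF bellman_function_exists])

lemma sq_const_pos: "1 < p \<Longrightarrow> 0 < sq_const p"
  using sq_const by (auto simp: bellman_def)

text \<open>Cauchy-Schwarz, then Young's inequality for (l a)(b/l) with the factors 1/p and 1/p'
  estimated by 1. The weight l serves to shrink the second summand until it can be absorbed.\<close>

lemma sum_mult_le_powr:
  fixes p p' l :: real and u v :: "'i \<Rightarrow> real"
  assumes p: "1 < p" "1 < p'" "1 / p + 1 / p' = 1" and l: "0 < l"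
  shows "(\<Sum>i\<in>I. u i * v i)
    \<le> l powr p * (\<Sum>i\<in>I. (u i)\<^sup>2) powr (p / 2) + (\<Sum>i\<in>I. (v i)\<^sup>2) powr (p' / 2) / l powr p'"
proof -
  define a where "a = sqrt (\<Sum>i\<in>I. (u i)\<^sup>2)"
  define b where "b = sqrt (\<Sum>i\<in>I. (v i)\<^sup>2)"
  have ab: "0 \<le> a" "0 \<le> b" by (simp_all add: a_def b_def sum_nonneg)
  have sq: "a\<^sup>2 = (\<Sum>i\<in>I. (u i)\<^sup>2)" "b\<^sup>2 = (\<Sum>i\<in>I. (v i)\<^sup>2)"
    by (simp_all add: a_def b_def sum_nonneg)
  have "(\<Sum>i\<in>I. u i * v i)\<^sup>2 \<le> (a * b)\<^sup>2"
    unfolding power_mult_distrib sq by (rule Cauchy_Schwarz_ineq_sum)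
  then have "(\<Sum>i\<in>I. u i * v i) \<le> a * b" by (rule power2_le_imp_le[OF _ mult_nonneg_nonneg[OF ab]])
  also have "\<dots> = (l * a) * (b / l)" using l by simp
  also have "\<dots> \<le> (l * a) powr p / p + (b / l) powr p' / p'"
    using l ab by (intro Youngs_inequality[OF p] mult_nonneg_nonneg divide_nonneg_pos) simp_all
  also have "\<dots> \<le> (l * a) powr p / 1 + (b / l) powr p' / 1"
    using p(1,2) by (intro add_mono divide_left_mono) simp_all
  also have "\<dots> = l powr p * a powr p + b powr p' / l powr p'"
    by (simp only: powr_mult powr_divide div_by_1)
  also have "a powr p = (\<Sum>i\<in>I. (u i)\<^sup>2) powr (p / 2)"
    using abs_powr_eq_square_powr[of a p] ab unfolding sq by simp
  also have "b powr p' = (\<Sum>i\<in>I. (v i)\<^sup>2) powr (p' / 2)"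
    using abs_powr_eq_square_powr[of b p'] ab unfolding sq by simp
  finally show ?thesis .
qed

text \<open>A filtration of finite algebras, given by the label \<open>P k x\<close> of the atom of generation \<open>k\<close>
  containing \<open>x\<close>. Atoms may be null sets; their averages are then the junk value \<open>0\<close>.\<close>
locale finite_filtration = finite_measure M for M :: "'a measure" +
  fixes P :: "nat \<Rightarrow> 'a \<Rightarrow> 'b"
  assumes cell_sets: "{x \<in> space M. P k x = c} \<in> sets M"
    and finite_labels: "finite (P k ` space M)"
    and refine: "x \<in> space M \<Longrightarrow> y \<in> space M \<Longrightarrow> P (Suc k) x = P (Suc k) y \<Longrightarrow> P k x = P k y"
begin

definition cell :: "nat \<Rightarrow> 'b \<Rightarrow> 'a set" where
  "cell k c = {x \<in> space M. P k x = c}"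

definition avg :: "nat \<Rightarrow> ('a \<Rightarrow> real) \<Rightarrow> 'b \<Rightarrow> real" where
  "avg k f c = (\<integral>x. indicator (cell k c) x * f x \<partial>M) / measure M (cell k c)"

definition E :: "nat \<Rightarrow> ('a \<Rightarrow> real) \<Rightarrow> 'a \<Rightarrow> real" where
  "E k f x = avg k f (P k x)"

definition D :: "nat \<Rightarrow> ('a \<Rightarrow> real) \<Rightarrow> 'a \<Rightarrow> real" where
  "D k f x = E (Suc k) f x - E k f x"

definition Sq :: "nat \<Rightarrow> ('a \<Rightarrow> real) \<Rightarrow> 'a \<Rightarrow> real" where
  "Sq n f x = (\<Sum>i<n. (D i f x)\<^sup>2)"

text \<open>Measurability with respect to the k-th algebra. As there are finitely many atoms, an
  adapted function takes finitely many values, so any function of it is integrable again.\<close>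

definition adapted :: "nat \<Rightarrow> ('a \<Rightarrow> 'c) \<Rightarrow> bool" where
  "adapted k h \<longleftrightarrow> (\<forall>x\<in>space M. \<forall>y\<in>space M. P k x = P k y \<longrightarrow> h x = h y)"

lemma cell_measurable [measurable]: "cell k c \<in> sets M"
  using cell_sets by (simp add: cell_def)

lemma adapted_comp: "adapted k f \<Longrightarrow> adapted k (\<lambda>x. F (f x))"
  unfolding adapted_def by (intro ballI impI arg_cong[where f=F]) blast

lemma adapted_comp2: "adapted k f \<Longrightarrow> adapted k g \<Longrightarrow> adapted k (\<lambda>x. F (f x) (g x))"
  unfolding adapted_def by (intro ballI impI arg_cong2[where f=F]) blast+

lemma adapted_sum: "(\<And>i. i \<in> I \<Longrightarrow> adapted k (f i)) \<Longrightarrow> adapted k (\<lambda>x. \<Sum>i\<in>I. f i x)"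
  unfolding adapted_def by (intro ballI impI sum.cong refl) blast

lemma adapted_mono:
  assumes "k \<le> l" "adapted k h"
  shows "adapted l h"
  using assms
proof (induction l rule: dec_induct)
  case (step l)
  show ?case
    unfolding adapted_def
  proof (intro ballI impI)
    fix x y assume xy: "x \<in> space M" "y \<in> space M" "P (Suc l) x = P (Suc l) y"
    from step.IH step.prems xy refine[OF xy] show "h x = h y" unfolding adapted_def by blast
  qed
qed

lemma adapted_E: "k \<le> l \<Longrightarrow> adapted l (E k f)"
  by (rule adapted_mono) (auto simp: adapted_def E_def)

lemma adapted_D: "k < l \<Longrightarrow> adapted l (D k f)"
  unfolding D_def[abs_def] by (rule adapted_comp2[where F="(-)", OF adapted_E adapted_E]) auto

lemma adapted_Sq: "n \<le> l \<Longrightarrow> adapted l (Sq n f)"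
  unfolding Sq_def[abs_def] by (rule adapted_sum, rule adapted_comp[where F="\<lambda>t. t\<^sup>2", OF adapted_D]) auto

lemma adapted_factor:
  assumes "adapted k h"
  shows "\<exists>g. \<forall>x\<in>space M. h x = g (P k x)"
proof (intro exI ballI)
  fix x assume x: "x \<in> space M"
  then have "(SOME y. y \<in> space M \<and> P k y = P k x) \<in> space M \<and> P k (SOME y. y \<in> space M \<and> P k y = P k x) = P k x"
    by (intro someI[where P="\<lambda>y. y \<in> space M \<and> P k y = P k x"]) simp
  then show "h x = (\<lambda>c. h (SOME y. y \<in> space M \<and> P k y = c)) (P k x)"
    using assms[unfolded adapted_def, rule_format, OF x] by simp
qed

text \<open>Exactly one cell contains x. Read from right to left, this resolves an adapted factor
  into indicators of cells, so integrals against it reduce to integrals over cells.\<close>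

lemma sum_cells:
  assumes "x \<in> space M"
  shows "(\<Sum>c\<in>P k ` space M. g c * (indicator (cell k c) x * t)) = g (P k x) * (t::real)"
proof -
  have "(\<Sum>c\<in>P k ` space M. g c * (indicator (cell k c) x * t)) =
    (\<Sum>c\<in>P k ` space M. if P k x = c then g c * t else 0)"
    using assms by (intro sum.cong) (auto simp: cell_def indicator_def)
  also have "\<dots> = g (P k x) * t" using assms finite_labels by (simp add: sum.delta)
  finally show ?thesis .
qed

lemma integrable_cell:
  assumes "integrable M f"
  shows "integrable M (\<lambda>x. indicator (cell k c) x * f x :: real)"
  using integrable_mult_indicator[OF cell_measurable assms, of k c] by simp

lemma integrable_adapted_mult:
  assumes "adapted k h" "integrable M f"
  shows "integrable M (\<lambda>x. h x * f x :: real)"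
proof -
  obtain g where g: "\<forall>x\<in>space M. h x = g (P k x)" using adapted_factor[OF assms(1)] ..
  have "integrable M (\<lambda>x. \<Sum>c\<in>P k ` space M. g c * (indicator (cell k c) x * f x))"
    using assms(2) by (intro Bochner_Integration.integrable_sum integrable_mult_right integrable_cell)
  then show ?thesis
    by (rule Bochner_Integration.integrable_cong[THEN iffD1, OF refl, rotated]) (simp add: g sum_cells)
qed

lemma integrable_adapted: "adapted k h \<Longrightarrow> integrable M (h :: 'a \<Rightarrow> real)"
  using integrable_adapted_mult[of k h "\<lambda>_. 1"] by simp

lemma integral_adapted_mult_E:
  assumes h: "adapted k h" and f: "integrable M f"
  shows "(\<integral>x. h x * E k f x \<partial>M) = (\<integral>x. h x * f x \<partial>M)"
proof -
  obtain g where g: "\<forall>x\<in>space M. h x = g (P k x)" using adapted_factor[OF h] ..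
  have "(\<integral>x. h x * E k f x \<partial>M) = (\<integral>x. (\<Sum>c\<in>P k ` space M. (g c * avg k f c) * (indicator (cell k c) x * 1)) \<partial>M)"
    using g by (intro Bochner_Integration.integral_cong refl) (subst sum_cells, auto simp: E_def)
  also have "\<dots> = (\<Sum>c\<in>P k ` space M. g c * avg k f c * measure M (cell k c))"
    by (subst Bochner_Integration.integral_sum[OF integrable_mult_right[OF integrable_cell]]) auto
  also have "\<dots> = (\<Sum>c\<in>P k ` space M. g c * (\<integral>x. indicator (cell k c) x * f x \<partial>M))"
  proof (intro sum.cong refl)
    fix c
    have "avg k f c * measure M (cell k c) = (\<integral>x. indicator (cell k c) x * f x \<partial>M)"
    proof (cases "measure M (cell k c) = 0")
      \<comment> \<open>On a null cell the integral vanishes as well, so the junk value of the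
        average does no harm.\<close>
      case True
      then have "cell k c \<in> null_sets M" by (simp add: null_sets_def emeasure_eq_measure)
      then have "(\<integral>x. indicator (cell k c) x * f x \<partial>M) = (\<integral>x. 0 \<partial>M)"
        using f by (intro integral_cong_AE) (auto dest!: AE_not_in intro!: borel_measurable_times elim!: eventually_mono)
      then show ?thesis using True by simp
    qed (simp add: avg_def)
    then show "g c * avg k f c * measure M (cell k c) = g c * (\<integral>x. indicator (cell k c) x * f x \<partial>M)"
      by simp
  qed
  also have "\<dots> = (\<integral>x. (\<Sum>c\<in>P k ` space M. g c * (indicator (cell k c) x * f x)) \<partial>M)"
    by (subst Bochner_Integration.integral_sum) (auto intro!: integrable_mult_right integrable_cell f)
  also have "\<dots> = (\<integral>x. h x * f x \<partial>M)"
    by (intro Bochner_Integration.integral_cong refl) (simp add: sum_cells g)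
  finally show ?thesis .
qed

lemma integral_adapted_mult_D:
  assumes h: "adapted k h" and f: "integrable M f"
  shows "(\<integral>x. h x * D k f x \<partial>M) = 0"
proof -
  have h': "adapted (Suc k) h" by (rule adapted_mono[OF _ h]) simp
  have "(\<integral>x. h x * D k f x \<partial>M) = (\<integral>x. h x * E (Suc k) f x \<partial>M) - (\<integral>x. h x * E k f x \<partial>M)"
    unfolding D_def right_diff_distrib
    by (intro Bochner_Integration.integral_diff integrable_adapted_mult[OF h'] integrable_adapted[OF adapted_E[OF order_refl]])
  also have "\<dots> = 0"
    using integral_adapted_mult_E[OF h f] integral_adapted_mult_E[OF h' f] by simp
  finally show ?thesis .
qed

text \<open>Jensen's inequality: the tangent inequality at \<open>E k f x\<close> is integrated. Its
  slope is adapted, so the linear term has integral zero.\<close>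

lemma integral_E_powr_le:
  assumes p: "1 < p" and f: "integrable M f" "integrable M (\<lambda>x. \<bar>f x\<bar> powr p)"
  shows "(\<integral>x. \<bar>E k f x\<bar> powr p \<partial>M) \<le> (\<integral>x. \<bar>f x\<bar> powr p \<partial>M)"
proof -
  let ?e = "E k f"
  have a: "adapted k ?e" by (simp add: adapted_E)
  have 1: "(\<integral>x. dpowr p (?e x) * ?e x \<partial>M) = (\<integral>x. dpowr p (?e x) * f x \<partial>M)"
    by (rule integral_adapted_mult_E[OF adapted_comp[where F="dpowr p", OF a] f(1)])
  have i1: "integrable M (\<lambda>x. \<bar>?e x\<bar> powr p)" by (rule integrable_adapted[OF adapted_comp[where F="\<lambda>t. \<bar>t\<bar> powr p", OF a]])
  have i2: "integrable M (\<lambda>x. dpowr p (?e x) * f x)" by (rule integrable_adapted_mult[OF adapted_comp[where F="dpowr p", OF a] f(1)])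
  have i3: "integrable M (\<lambda>x. dpowr p (?e x) * ?e x)" by (rule integrable_adapted[OF adapted_comp[where F="\<lambda>t. dpowr p t * t", OF a]])
  have "(\<integral>x. \<bar>?e x\<bar> powr p + (dpowr p (?e x) * f x - dpowr p (?e x) * ?e x) \<partial>M) \<le> (\<integral>x. \<bar>f x\<bar> powr p \<partial>M)"
    using i1 i2 i3 f abs_powr_tangent[OF p] by (intro integral_mono) (auto simp: algebra_simps)
  then show ?thesis using 1 i1 i2 i3 by simp
qed

lemma integral_bellman_le:
  fixes U \<phi> :: "real \<Rightarrow> real \<Rightarrow> real"
  assumes U: "\<And>x d q. 0 \<le> q \<Longrightarrow> U (x + d) (q + d\<^sup>2) \<le> U x q + \<phi> x q * d"
    and f: "integrable M f"
  shows "(\<integral>x. U (E n f x) (Sq n f x) \<partial>M) \<le> (\<integral>x. U (E 0 f x) 0 \<partial>M)"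
proof (induction n)
  case (Suc n)
  have 1: "integrable M (\<lambda>x. U (E k f x) (Sq k f x))" for k
    by (rule integrable_adapted[OF adapted_comp2[where F=U, OF adapted_E adapted_Sq]]) auto
  have 2: "integrable M (\<lambda>x. \<phi> (E n f x) (Sq n f x) * D n f x)"
    by (rule integrable_adapted_mult[OF adapted_comp2[where F=\<phi>, OF adapted_E adapted_Sq] integrable_adapted[OF adapted_D]]) auto
  have "(\<integral>x. U (E (Suc n) f x) (Sq (Suc n) f x) \<partial>M)
    \<le> (\<integral>x. U (E n f x) (Sq n f x) + \<phi> (E n f x) (Sq n f x) * D n f x \<partial>M)"
  proof (intro integral_mono 1 Bochner_Integration.integrable_add 2)
    fix x
    have "0 \<le> Sq n f x" by (simp add: Sq_def sum_nonneg)
    from U[OF this, of "E n f x" "D n f x"]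
    show "U (E (Suc n) f x) (Sq (Suc n) f x) \<le> U (E n f x) (Sq n f x) + \<phi> (E n f x) (Sq n f x) * D n f x"
      by (simp add: D_def Sq_def)
  qed
  also have "\<dots> = (\<integral>x. U (E n f x) (Sq n f x) \<partial>M) + (\<integral>x. \<phi> (E n f x) (Sq n f x) * D n f x \<partial>M)"
    using 1 2 by simp
  also have "(\<integral>x. \<phi> (E n f x) (Sq n f x) * D n f x \<partial>M) = 0"
    by (rule integral_adapted_mult_D[OF adapted_comp2[where F=\<phi>, OF adapted_E adapted_Sq] f]) auto
  finally show ?case using Suc by simp
qed (simp add: Sq_def)

theorem integral_Sq_powr_le:
  assumes p: "1 < p" and f: "integrable M f" "integrable M (\<lambda>x. \<bar>f x\<bar> powr p)"
  shows "(\<integral>x. Sq n f x powr (p / 2) \<partial>M) \<le> sq_const p * (\<integral>x. \<bar>f x\<bar> powr p \<partial>M)"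
proof -
  obtain U \<phi> where "bellman p (sq_const p) U \<phi>" using sq_const[OF p] by blast
  then have U: "\<And>x d q. 0 \<le> q \<Longrightarrow> U (x + d) (q + d\<^sup>2) \<le> U x q + \<phi> x q * d"
    "\<And>x. U x 0 \<le> 0" "\<And>x q. 0 \<le> q \<Longrightarrow> q powr (p / 2) \<le> U x q + sq_const p * \<bar>x\<bar> powr p"
    by (auto simp: bellman_def)
  have i1: "integrable M (\<lambda>x. U (E k f x) (Sq k f x))" for k
    by (rule integrable_adapted[OF adapted_comp2[where F=U, OF adapted_E adapted_Sq]]) auto
  have i2: "integrable M (\<lambda>x. \<bar>E n f x\<bar> powr p)" by (rule integrable_adapted[OF adapted_comp[where F="\<lambda>t. \<bar>t\<bar> powr p", OF adapted_E[OF order_refl]]])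
  have i3: "integrable M (\<lambda>x. U (E 0 f x) 0)"
    using i1[of 0] by (simp add: Sq_def)
  have "(\<integral>x. Sq n f x powr (p / 2) \<partial>M) \<le> (\<integral>x. U (E n f x) (Sq n f x) + sq_const p * \<bar>E n f x\<bar> powr p \<partial>M)"
  proof (rule integral_mono)
    show "integrable M (\<lambda>x. Sq n f x powr (p / 2))" by (rule integrable_adapted[OF adapted_comp[where F="\<lambda>t. t powr (p / 2)", OF adapted_Sq[OF order_refl]]])
    show "Sq n f x powr (p / 2) \<le> U (E n f x) (Sq n f x) + sq_const p * \<bar>E n f x\<bar> powr p" for x
      by (rule U) (simp add: Sq_def sum_nonneg)
  qed (use i1 i2 in auto)
  also have "\<dots> = (\<integral>x. U (E n f x) (Sq n f x) \<partial>M) + sq_const p * (\<integral>x. \<bar>E n f x\<bar> powr p \<partial>M)"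
    using i1 i2 by simp
  also have "(\<integral>x. U (E n f x) (Sq n f x) \<partial>M) \<le> (\<integral>x. U (E 0 f x) 0 \<partial>M)"
    using U(1) f(1) by (rule integral_bellman_le)
  also have "\<dots> \<le> (\<integral>x. 0 \<partial>M)" using i3 U(2) by (intro integral_mono) auto
  \<comment> \<open>Jensen's inequality removes the last trace of n from the bound.\<close>
  also have "(\<integral>x. \<bar>E n f x\<bar> powr p \<partial>M) \<le> (\<integral>x. \<bar>f x\<bar> powr p \<partial>M)"
    using p f by (rule integral_E_powr_le)
  finally show ?thesis using sq_const_pos[OF p] by simp
qed

theorem integral_martingale_powr_le:
  fixes p p' :: real
  assumes p: "1 < p" "1 < p'" "1 / p + 1 / p' = 1" and f: "integrable M f"
  shows "(\<integral>x. \<bar>E n f x - E 0 f x\<bar> powr p \<partial>M)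
    \<le> 2 * (2 * sq_const p') powr (p / p') * (\<integral>x. Sq n f x powr (p / 2) \<partial>M)"
proof -
  define K where "K = sq_const p'"
  have K: "0 < K" unfolding K_def by (rule sq_const_pos[OF p(2)])
  define u where "u = (\<lambda>x. E n f x - E 0 f x)"
  \<comment> \<open>The extremal function in Hoelder's inequality: u g = |u|^p = |g|^p'. As a
    function of u it is adapted, so the upper bound applies to it.\<close>
  define g where "g = (\<lambda>x. sgn (u x) * \<bar>u x\<bar> powr (p - 1))"
  have au: "adapted n u" unfolding u_def by (rule adapted_comp2[where F="(-)", OF adapted_E adapted_E]) auto
  have ag: "adapted n g" unfolding g_def by (rule adapted_comp[where F="\<lambda>t. sgn t * \<bar>t\<bar> powr (p - 1)", OF au])
  have ig: "integrable M g" by (rule integrable_adapted[OF ag])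
  have pp: "(p - 1) * p' = p" using p by (simp add: field_simps)
  have gp: "\<bar>g x\<bar> powr p' = \<bar>u x\<bar> powr p" for x
    using p by (cases "u x = 0") (auto simp: g_def abs_mult powr_powr pp)
  have ug: "u x * g x = \<bar>u x\<bar> powr p" for x
  proof (cases "u x = 0")
    case False
    have "u x * g x = \<bar>u x\<bar> * \<bar>u x\<bar> powr (p - 1)" by (simp add: g_def abs_sgn mult.assoc)
    also have "\<dots> = \<bar>u x\<bar> powr p" using False powr_add[of "\<bar>u x\<bar>" 1 "p - 1"] by simp
    finally show ?thesis .
  qed simp
  have iu: "integrable M (\<lambda>x. \<bar>u x\<bar> powr p)" by (rule integrable_adapted[OF adapted_comp[where F="\<lambda>t. \<bar>t\<bar> powr p", OF au]])
  have usum: "u x = (\<Sum>i<n. D i f x)" for x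
    unfolding u_def D_def by (simp add: sum_lessThan_telescope[of "\<lambda>i. E i f x"])
  have iDg: "integrable M (\<lambda>x. D i f x * g x)" if "i < n" for i
    by (rule integrable_adapted_mult[OF adapted_D[OF that] ig])
  have iDD: "integrable M (\<lambda>x. D i f x * D i g x)" if "i < n" for i
    by (intro integrable_adapted_mult[OF adapted_D[OF that]] integrable_adapted[OF adapted_D[OF that]])
  \<comment> \<open>\<open>D i f\<close> is adapted to generation \<open>Suc i\<close>, so g may be
    replaced by \<open>E (Suc i) g\<close>, that is, by \<open>D i g + E i g\<close>. The part
    \<open>E i g\<close> is orthogonal to \<open>D i f\<close>.\<close>
  have orth: "(\<integral>x. D i f x * g x \<partial>M) = (\<integral>x. D i f x * D i g x \<partial>M)" for i
  proof -
    have "(\<integral>x. D i f x * g x \<partial>M) = (\<integral>x. D i f x * E (Suc i) g x \<partial>M)"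
      by (rule integral_adapted_mult_E[symmetric]) (auto intro!: adapted_D ig)
    also have "\<dots> = (\<integral>x. D i f x * D i g x + E i g x * D i f x \<partial>M)"
      by (intro Bochner_Integration.integral_cong refl) (simp add: D_def algebra_simps)
    also have "\<dots> = (\<integral>x. D i f x * D i g x \<partial>M) + (\<integral>x. E i g x * D i f x \<partial>M)"
      by (intro Bochner_Integration.integral_add integrable_adapted_mult[OF adapted_D[OF lessI]]
          integrable_adapted_mult[OF adapted_E[OF order_refl]] integrable_adapted[OF adapted_D[OF lessI]])
    also have "(\<integral>x. E i g x * D i f x \<partial>M) = 0"
      by (rule integral_adapted_mult_D[OF adapted_E[OF order_refl] f])
    finally show ?thesis by simp
  qed
  \<comment> \<open>With l^p' = 2 K the square function of g costs at most half of the integral of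
    |u|^p, and this half is moved to the left at the end.\<close>
  define l where "l = (2 * K) powr (1 / p')"
  have l: "0 < l" using K by (simp add: l_def)
  have lp': "l powr p' = 2 * K" using K p by (simp add: l_def powr_powr)
  have lp: "l powr p = (2 * K) powr (p / p')" by (simp add: l_def powr_powr)
  have young: "(\<Sum>i<n. D i f x * D i g x) \<le> l powr p * Sq n f x powr (p / 2) + Sq n g x powr (p' / 2) / (2 * K)" for x
    unfolding Sq_def lp'[symmetric] by (rule sum_mult_le_powr[OF p l])
  have iS: "integrable M (\<lambda>x. Sq n h x powr s)" for h s
    by (rule integrable_adapted[OF adapted_comp[where F="\<lambda>t. t powr s", OF adapted_Sq[OF order_refl]]])
  have "(\<integral>x. \<bar>u x\<bar> powr p \<partial>M) = (\<integral>x. (\<Sum>i<n. D i f x * g x) \<partial>M)"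
    by (intro Bochner_Integration.integral_cong refl) (metis ug usum sum_distrib_right)
  also have "\<dots> = (\<Sum>i<n. (\<integral>x. D i f x * D i g x \<partial>M))"
    by (subst Bochner_Integration.integral_sum) (auto simp: iDg orth)
  also have "\<dots> = (\<integral>x. (\<Sum>i<n. D i f x * D i g x) \<partial>M)"
    by (subst Bochner_Integration.integral_sum) (auto simp: iDD)
  also have "\<dots> \<le> (\<integral>x. l powr p * Sq n f x powr (p / 2) + Sq n g x powr (p' / 2) / (2 * K) \<partial>M)"
    by (intro integral_mono Bochner_Integration.integrable_sum Bochner_Integration.integrable_add
        integrable_mult_right integrable_divide iS iDD young) auto
  also have "\<dots> = l powr p * (\<integral>x. Sq n f x powr (p / 2) \<partial>M) + (\<integral>x. Sq n g x powr (p' / 2) \<partial>M) / (2 * K)"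
    using iS by simp
  also have "(\<integral>x. Sq n g x powr (p' / 2) \<partial>M) \<le> K * (\<integral>x. \<bar>g x\<bar> powr p' \<partial>M)"
    unfolding K_def by (rule integral_Sq_powr_le[OF p(2) ig]) (simp add: gp iu)
  also have "(\<integral>x. \<bar>g x\<bar> powr p' \<partial>M) = (\<integral>x. \<bar>u x\<bar> powr p \<partial>M)" by (simp add: gp)
  finally have "(\<integral>x. \<bar>u x\<bar> powr p \<partial>M) \<le> l powr p * (\<integral>x. Sq n f x powr (p / 2) \<partial>M) + (\<integral>x. \<bar>u x\<bar> powr p \<partial>M) / 2"
    using K by (simp add: divide_right_mono)
  then show ?thesis unfolding u_def lp K_def by simp
qed

text \<open>The contraction property for exponent 1, obtained by testing against the sign of
  \<open>E k f\<close>, which is adapted.\<close>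

lemma integral_abs_E_le:
  assumes f: "integrable M f"
  shows "(\<integral>x. \<bar>E k f x\<bar> \<partial>M) \<le> (\<integral>x. \<bar>f x\<bar> \<partial>M)"
proof -
  have a: "adapted k (\<lambda>x. sgn (E k f x))" by (rule adapted_comp[where F=sgn, OF adapted_E[OF order_refl]])
  have "(\<integral>x. \<bar>E k f x\<bar> \<partial>M) = (\<integral>x. sgn (E k f x) * E k f x \<partial>M)" by (simp add: abs_sgn mult.commute)
  also have "\<dots> = (\<integral>x. sgn (E k f x) * f x \<partial>M)" by (rule integral_adapted_mult_E[OF a f])
  also have "\<dots> \<le> (\<integral>x. \<bar>f x\<bar> \<partial>M)"
    by (intro integral_mono integrable_adapted_mult[OF a f] integrable_abs f) (auto simp: sgn_if)
  finally show ?thesis .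
qed

lemma E_diff:
  assumes "integrable M f" "integrable M g"
  shows "E k (\<lambda>x. f x - g x) x = E k f x - E k g x"
  unfolding E_def avg_def right_diff_distrib
  by (simp add: Bochner_Integration.integral_diff[OF integrable_cell integrable_cell] assms diff_divide_distrib)

text \<open>The class of functions h with E_i h -> h in L^1 is closed under dominated limits: E_i f
  - f splits into E_i (f - s_n), E_i s_n - s_n and s_n - f, and the contraction property bounds the
  first by the third, uniformly in i.\<close>

lemma tendsto_L1_E_dominated:
  assumes s: "\<And>n. integrable M (s n)" "\<And>n. (\<lambda>i. \<integral>x. \<bar>E i (s n) x - s n x\<bar> \<partial>M) \<longlonglongrightarrow> 0"
    and f: "f \<in> borel_measurable M" and w: "integrable M w"
    and lim: "AE x in M. (\<lambda>n. s n x) \<longlonglongrightarrow> f x" and dom: "\<And>n. AE x in M. \<bar>s n x\<bar> \<le> w x"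
  shows "(\<lambda>i. \<integral>x. \<bar>E i f x - f x\<bar> \<partial>M) \<longlonglongrightarrow> 0"
proof -
  have sm: "s n \<in> borel_measurable M" for n using s(1) by (rule borel_measurable_integrable)
  have fi: "integrable M f"
    by (rule integrable_dominated_convergence[OF f sm w lim]) (use dom in simp)
  have iE: "integrable M (E i h)" for i h by (rule integrable_adapted[OF adapted_E[OF order_refl]])
  have conv: "(\<lambda>n. \<integral>x. \<bar>f x - s n x\<bar> \<partial>M) \<longlonglongrightarrow> (\<integral>x. 0 \<partial>M)"
  proof (rule integral_dominated_convergence)
    show "integrable M (\<lambda>x. \<bar>f x\<bar> + w x)" using fi w by auto
    show "AE x in M. (\<lambda>n. \<bar>f x - s n x\<bar>) \<longlonglongrightarrow> 0"
      using lim
    proof eventually_elim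
      case (elim x)
      from tendsto_rabs[OF tendsto_diff[OF tendsto_const[of "f x"] elim]] show ?case by simp
    qed
    show "AE x in M. norm \<bar>f x - s n x\<bar> \<le> \<bar>f x\<bar> + w x" for n
      using dom[of n] by eventually_elim auto
  qed (use f sm in auto)
  show ?thesis
  proof (rule LIMSEQ_I)
    fix e :: real assume e: "0 < e"
    have "\<forall>\<^sub>F n in sequentially. (\<integral>x. \<bar>f x - s n x\<bar> \<partial>M) < e / 3"
      using conv e by (intro order_tendstoD) auto
    then obtain n where n: "(\<integral>x. \<bar>f x - s n x\<bar> \<partial>M) < e / 3"
      by (auto simp: eventually_sequentially)
    have "\<forall>\<^sub>F i in sequentially. (\<integral>x. \<bar>E i (s n) x - s n x\<bar> \<partial>M) < e / 3"
      using s(2) e by (intro order_tendstoD) auto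
    then obtain k where k: "\<And>i. k \<le> i \<Longrightarrow> (\<integral>x. \<bar>E i (s n) x - s n x\<bar> \<partial>M) < e / 3"
      by (auto simp: eventually_sequentially)
    have fs: "integrable M (\<lambda>x. f x - s n x)" using fi s(1) by auto
    have "norm ((\<integral>x. \<bar>E i f x - f x\<bar> \<partial>M) - 0) < e" if "k \<le> i" for i
    proof -
      have "(\<integral>x. \<bar>E i f x - f x\<bar> \<partial>M)
        \<le> (\<integral>x. \<bar>E i (\<lambda>x. f x - s n x) x\<bar> + \<bar>E i (s n) x - s n x\<bar> + \<bar>f x - s n x\<bar> \<partial>M)"
        using fi s(1)[of n] iE by (intro integral_mono Bochner_Integration.integrable_add integrable_abs
            Bochner_Integration.integrable_diff) (auto simp: E_diff)
      also have "\<dots> = (\<integral>x. \<bar>E i (\<lambda>x. f x - s n x) x\<bar> \<partial>M) + (\<integral>x. \<bar>E i (s n) x - s n x\<bar> \<partial>M)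
          + (\<integral>x. \<bar>f x - s n x\<bar> \<partial>M)"
        using fi s(1)[of n] iE by simp
      also have "\<dots> < e" using integral_abs_E_le[OF fs, of i] n k[OF that] by linarith
      finally show ?thesis by simp
    qed
    then show "\<exists>k. \<forall>i\<ge>k. norm ((\<integral>x. \<bar>E i f x - f x\<bar> \<partial>M) - 0) < e" by blast
  qed
qed

end

section \<open>Dyadic cubes\<close>

text \<open>The atom label of the dyadic filtration. With labels in place of sets, passing to the
  parent cube is integer division by 2 in each coordinate.\<close>

definition cube_index :: "int \<Rightarrow> real ^ 'n \<Rightarrow> int ^ 'n" where
  "cube_index k x = (\<chi> i. \<lfloor>2 powi k * x $ i\<rfloor>)"

lemma mem_dyadic_cube: "x \<in> dyadic_cube k m \<longleftrightarrow> cube_index k x = m"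
  unfolding mem_dyadic_cube_iff cube_index_def by auto

lemma mem_dyadic_cube_at: "y \<in> dyadic_cube_at k x \<longleftrightarrow> cube_index k y = cube_index k x"
  unfolding dyadic_cube_at_def mem_dyadic_cube cube_index_def ..

lemma dyadic_cube_at_eq: "dyadic_cube_at k x = dyadic_cube k (cube_index k x)"
  by (simp add: dyadic_cube_at_def cube_index_def)

lemma cube_index_pred:
  "cube_index (k - 1) x = (\<chi> i. cube_index k x $ i div 2)"
proof -
  have "\<lfloor>2 powi (k - 1) * t\<rfloor> = \<lfloor>2 powi k * t\<rfloor> div 2" for t :: real
  proof -
    have "2 powi (k - 1) * t = 2 powi k * t / of_int 2"
      by (simp add: power_int_diff)
    then show ?thesis using floor_divide_real_eq_div[of 2 "2 powi k * t"] by (simp only: of_int_numeral zero_le_numeral simp_thms)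
  qed
  then show ?thesis by (simp add: cube_index_def vec_eq_iff)
qed

lemma cube_index_mono:
  assumes "cube_index (k + int i) x = cube_index (k + int i) y"
  shows "cube_index k x = cube_index k y"
  using assms
proof (induction i)
  case (Suc i)
  then show ?case
    using cube_index_pred[of "k + int (Suc i)" x] cube_index_pred[of "k + int (Suc i)" y] by simp
qed simp

lemma dyadic_cube_between:
  fixes m :: "int ^ 'n" and k :: int
  defines "a \<equiv> (\<chi> i. of_int (m $ i) * 2 powi (- k)) :: real ^ 'n"
    and "b \<equiv> (\<chi> i. (of_int (m $ i) + 1) * 2 powi (- k)) :: real ^ 'n"
  shows "box a b \<subseteq> dyadic_cube k m" "dyadic_cube k m \<subseteq> cbox a b"
  by (auto simp: dyadic_cube_def a_def b_def mem_box_cart less_imp_le)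

lemma dyadic_cube_borel [measurable]: "dyadic_cube k m \<in> sets borel"
  unfolding dyadic_cube_def by measurable

lemma dyadic_cube_lebesgue [measurable]: "dyadic_cube k m \<in> sets lebesgue"
  using dyadic_cube_borel by (simp add: sets_completionI_sets)

lemma dyadic_cube_lmeasurable: "dyadic_cube k m \<in> lmeasurable"
  using dyadic_cube_between(2)[of k m] dyadic_cube_lebesgue
  by (meson bounded_cbox bounded_set_imp_lmeasurable bounded_subset)

text \<open>Serves twice: the averages have positive denominators, and the volume grows without
  bound as the generation tends to minus infinity.\<close>

lemma measure_dyadic_cube_ge:
  fixes m :: "int ^ 'n"
  shows "(2 powi (- k)) ^ CARD('n) \<le> measure lebesgue (dyadic_cube k m)"
proof -
  define a where "a = ((\<chi> i. of_int (m $ i) * 2 powi (- k)) :: real ^ 'n)"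
  define b where "b = ((\<chi> i. (of_int (m $ i) + 1) * 2 powi (- k)) :: real ^ 'n)"
  have ab: "box a b \<subseteq> dyadic_cube k m" using dyadic_cube_between(1)[of m k] by (simp add: a_def b_def)
  have "a $ i \<le> b $ i" for i by (simp add: a_def b_def)
  then have "cbox a b \<noteq> {}" by (simp add: interval_ne_empty_cart)
  then have "measure lebesgue (cbox a b) = (\<Prod>i\<in>UNIV. b $ i - a $ i)"
    by (simp add: content_cbox_cart)
  also have "\<dots> = (2 powi (- k)) ^ CARD('n)" by (simp add: a_def b_def algebra_simps)
  finally have "measure lebesgue (box a b) = (2 powi (- k)) ^ CARD('n)"
    by (simp add: measure_lborel_box_eq measure_lborel_cbox_eq)
  then show ?thesis
    using measure_mono_fmeasurable[OF ab _ dyadic_cube_lmeasurable] by simp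
qed

lemma finite_vec_bounded: "finite {m :: int ^ 'n. \<forall>i. m $ i \<in> {a $ i..b $ i}}"
proof -
  have "{m :: int ^ 'n. \<forall>i. m $ i \<in> {a $ i..b $ i}} \<subseteq> vec_lambda ` (PiE UNIV (\<lambda>i. {a $ i..b $ i}))"
  proof
    fix m :: "int ^ 'n" assume "m \<in> {m. \<forall>i. m $ i \<in> {a $ i..b $ i}}"
    then show "m \<in> vec_lambda ` (PiE UNIV (\<lambda>i. {a $ i..b $ i}))"
      by (intro image_eqI[of _ _ "vec_nth m"]) auto
  qed
  then show ?thesis by (rule finite_subset) (auto intro!: finite_imageI finite_PiE)
qed

lemma finite_cube_index_image:
  fixes m :: "int ^ 'n"
  shows "finite (cube_index k ` dyadic_cube j m)"
proof -
  let ?a = "(\<chi> i. \<lfloor>2 powi k * (of_int (m $ i) * 2 powi (- j) :: real)\<rfloor>) :: int ^ 'n"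
  let ?b = "(\<chi> i. \<lfloor>2 powi k * ((of_int (m $ i) + 1) * 2 powi (- j) :: real)\<rfloor>) :: int ^ 'n"
  have "cube_index k ` dyadic_cube j m \<subseteq> {m. \<forall>i. m $ i \<in> {?a $ i..?b $ i}}"
  proof safe
    fix x i assume "x \<in> dyadic_cube j m"
    then have "of_int (m $ i) * 2 powi (- j) \<le> x $ i" "x $ i \<le> (of_int (m $ i) + 1) * 2 powi (- j)"
      by (auto simp: dyadic_cube_def less_imp_le)
    then show "cube_index k x $ i \<in> {?a $ i..?b $ i}"
      by (auto simp: cube_index_def intro!: floor_mono mult_left_mono)
  qed
  then show ?thesis by (rule finite_subset) (rule finite_vec_bounded)
qed

text \<open>On a cube of generation \<open>j\<close> the time index \<open>i\<close> of the filtration is the generation \<open>j + i\<close>.\<close>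
lemma finite_filtration_dyadic_cube:
  "finite_filtration (lebesgue_on (dyadic_cube j m)) (\<lambda>i x. cube_index (j + int i) x)"
proof -
  let ?M = "lebesgue_on (dyadic_cube j m)"
  interpret finite_measure ?M
    using dyadic_cube_lmeasurable by (rule finite_measure_lebesgue_on)
  show ?thesis
  proof
    fix k c
    have "{x \<in> space ?M. cube_index (j + int k) x = c} = dyadic_cube j m \<inter> dyadic_cube (j + int k) c"
      by (auto simp: mem_dyadic_cube)
    then show "{x \<in> space ?M. cube_index (j + int k) x = c} \<in> sets ?M"
      by (auto simp: sets_restrict_space_iff)
    show "finite ((\<lambda>x. cube_index (j + int k) x) ` space ?M)"
      by (simp add: finite_cube_index_image)
    fix x y :: "real ^ 'a" assume "cube_index (j + int (Suc k)) x = cube_index (j + int (Suc k)) y"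
    then have "cube_index ((j + int k) + int 1) x = cube_index ((j + int k) + int 1) y"
      by (simp add: algebra_simps)
    then show "cube_index (j + int k) x = cube_index (j + int k) y"
      by (rule cube_index_mono)
  qed
qed

definition dyE :: "int \<Rightarrow> (real ^ 'n \<Rightarrow> real) \<Rightarrow> real ^ 'n \<Rightarrow> real" where
  "dyE k f x = (LINT y:dyadic_cube_at k x|lebesgue. f y) / measure lebesgue (dyadic_cube_at k x)"

definition dyD :: "int \<Rightarrow> (real ^ 'n \<Rightarrow> real) \<Rightarrow> real ^ 'n \<Rightarrow> real" where
  "dyD k f x = dyE k f x - dyE (k - 1) f x"

context
  fixes j :: int and m :: "int ^ 'n"
begin

interpretation Q: finite_filtration "lebesgue_on (dyadic_cube j m)" "\<lambda>i x. cube_index (j + int i) x"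
  by (rule finite_filtration_dyadic_cube)

lemma cell_dyadic:
  assumes "x \<in> dyadic_cube j m"
  shows "Q.cell i (cube_index (j + int i) x) = dyadic_cube_at (j + int i) x"
  using assms unfolding Q.cell_def by (auto simp: mem_dyadic_cube_at mem_dyadic_cube dest: cube_index_mono)

text \<open>The finer cube around x lies inside the given one, so restricting the measure changes
  neither its volume nor the integral over it.\<close>

lemma E_dyadic:
  assumes "x \<in> dyadic_cube j m"
  shows "Q.E i f x = dyE (j + int i) f x"
proof -
  let ?C = "dyadic_cube_at (j + int i) x"
  have sub: "?C \<subseteq> dyadic_cube j m"
    unfolding cell_dyadic[OF assms, symmetric] by (auto simp: Q.cell_def)
  have C: "?C \<in> sets lebesgue" by (simp add: dyadic_cube_at_eq)
  have "measure (lebesgue_on (dyadic_cube j m)) ?C = measure lebesgue ?C"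
    using sub by (intro measure_restrict_space) auto
  moreover have "(\<integral>y. indicator ?C y * f y \<partial>lebesgue_on (dyadic_cube j m)) = (LINT y:?C|lebesgue. f y)"
    using sub by (subst integral_restrict_space)
      (auto simp: set_lebesgue_integral_def intro!: Bochner_Integration.integral_cong split: split_indicator)
  ultimately show ?thesis
    unfolding Q.E_def Q.avg_def dyE_def cell_dyadic[OF assms] by simp
qed

text \<open>The shift by one comes from the conventions: \<open>Q.D i\<close> looks forward from
  time i, whereas \<open>dyD k\<close> looks back from generation k. The first n time steps thus
  give the generations j + 1 to j + n.\<close>

lemma D_dyadic:
  assumes "x \<in> dyadic_cube j m"
  shows "Q.D i f x = dyD (j + int i + 1) f x"
  by (simp add: Q.D_def dyD_def E_dyadic[OF assms] algebra_simps)

lemma Sq_dyadic: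
  assumes "x \<in> dyadic_cube j m"
  shows "Q.Sq n f x = (\<Sum>k\<in>{j + 1..j + int n}. (dyD k f x)\<^sup>2)"
proof -
  have "(\<Sum>k\<in>{j + 1..j + int n}. (dyD k f x)\<^sup>2) = (\<Sum>i<n. (dyD (j + int i + 1) f x)\<^sup>2)"
    by (rule sum.reindex_bij_witness[where i="\<lambda>i. j + int i + 1" and j="\<lambda>k. nat (k - j - 1)"]) auto
  then show ?thesis by (simp add: Q.Sq_def D_dyadic[OF assms])
qed

text \<open>Restated with integrals in [0, \<infinity>], the bound can be summed over all cubes and
  passed to the limit.\<close>

lemma cube_square_function_le:
  assumes p: "1 < p" and f: "integrable (lebesgue_on (dyadic_cube j m)) f"
    "integrable (lebesgue_on (dyadic_cube j m)) (\<lambda>x. \<bar>f x\<bar> powr p)"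
  shows "(\<integral>\<^sup>+x. ennreal ((\<Sum>k\<in>{j + 1..j + int n}. (dyD k f x)\<^sup>2) powr (p / 2)) \<partial>lebesgue_on (dyadic_cube j m))
     \<le> ennreal (sq_const p) * (\<integral>\<^sup>+x. ennreal (\<bar>f x\<bar> powr p) \<partial>lebesgue_on (dyadic_cube j m))"
proof -
  let ?M = "lebesgue_on (dyadic_cube j m)"
  have i: "integrable ?M (\<lambda>x. Q.Sq n f x powr (p / 2))"
    by (rule Q.integrable_adapted[OF Q.adapted_comp[where F="\<lambda>t. t powr (p / 2)", OF Q.adapted_Sq[OF order_refl]]])
  have "(\<integral>\<^sup>+x. ennreal ((\<Sum>k\<in>{j + 1..j + int n}. (dyD k f x)\<^sup>2) powr (p / 2)) \<partial>?M)
      = (\<integral>\<^sup>+x. ennreal (Q.Sq n f x powr (p / 2)) \<partial>?M)"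
    by (intro nn_integral_cong) (simp add: Sq_dyadic)
  also have "\<dots> = ennreal (\<integral>x. Q.Sq n f x powr (p / 2) \<partial>?M)"
    using i by (intro nn_integral_eq_integral) auto
  also have "\<dots> \<le> ennreal (sq_const p * (\<integral>x. \<bar>f x\<bar> powr p \<partial>?M))"
    using p f by (intro ennreal_leI Q.integral_Sq_powr_le)
  also have "\<dots> = ennreal (sq_const p) * (\<integral>\<^sup>+x. ennreal (\<bar>f x\<bar> powr p) \<partial>?M)"
    using f(2) sq_const_pos[OF p] by (subst nn_integral_eq_integral) (auto simp: ennreal_mult')
  finally show ?thesis .
qed

lemma cube_martingale_le:
  assumes p: "1 < p" "1 < p'" "1 / p + 1 / p' = 1" and f: "integrable (lebesgue_on (dyadic_cube j m)) f"
  shows "(\<integral>\<^sup>+x. ennreal (\<bar>dyE (j + int n) f x - dyE j f x\<bar> powr p) \<partial>lebesgue_on (dyadic_cube j m))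
     \<le> ennreal (2 * (2 * sq_const p') powr (p / p')) *
        (\<integral>\<^sup>+x. ennreal ((\<Sum>k\<in>{j + 1..j + int n}. (dyD k f x)\<^sup>2) powr (p / 2)) \<partial>lebesgue_on (dyadic_cube j m))"
proof -
  let ?M = "lebesgue_on (dyadic_cube j m)"
  have i: "integrable ?M (\<lambda>x. Q.Sq n f x powr (p / 2))"
    by (rule Q.integrable_adapted[OF Q.adapted_comp[where F="\<lambda>t. t powr (p / 2)", OF Q.adapted_Sq[OF order_refl]]])
  have "Q.adapted n (\<lambda>x. Q.E n f x - Q.E 0 f x)"
    by (rule Q.adapted_comp2[where F="(-)", OF Q.adapted_E Q.adapted_E]) auto
  then have i': "integrable ?M (\<lambda>x. \<bar>Q.E n f x - Q.E 0 f x\<bar> powr p)"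
    by (rule Q.integrable_adapted[OF Q.adapted_comp[where F="\<lambda>t. \<bar>t\<bar> powr p"]])
  have "(\<integral>\<^sup>+x. ennreal (\<bar>dyE (j + int n) f x - dyE j f x\<bar> powr p) \<partial>?M)
      = (\<integral>\<^sup>+x. ennreal (\<bar>Q.E n f x - Q.E 0 f x\<bar> powr p) \<partial>?M)"
    by (intro nn_integral_cong) (simp add: E_dyadic)
  also have "\<dots> = ennreal (\<integral>x. \<bar>Q.E n f x - Q.E 0 f x\<bar> powr p \<partial>?M)"
    using i' by (intro nn_integral_eq_integral) auto
  also have "\<dots> \<le> ennreal (2 * (2 * sq_const p') powr (p / p') * (\<integral>x. Q.Sq n f x powr (p / 2) \<partial>?M))"
    by (intro ennreal_leI Q.integral_martingale_powr_le[OF p f])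
  also have "\<dots> = ennreal (2 * (2 * sq_const p') powr (p / p')) * (\<integral>\<^sup>+x. ennreal (Q.Sq n f x powr (p / 2)) \<partial>?M)"
    using i by (subst nn_integral_eq_integral) (auto simp: ennreal_mult')
  also have "(\<integral>\<^sup>+x. ennreal (Q.Sq n f x powr (p / 2)) \<partial>?M)
      = (\<integral>\<^sup>+x. ennreal ((\<Sum>k\<in>{j + 1..j + int n}. (dyD k f x)\<^sup>2) powr (p / 2)) \<partial>?M)"
    by (intro nn_integral_cong) (simp add: Sq_dyadic)
  finally show ?thesis .
qed

text \<open>Jensen's inequality at time 0, where the only atom is the whole cube and the expectation
  is a single number.\<close>

lemma cube_average_powr_le:
  assumes p: "1 < p" and f: "integrable (lebesgue_on (dyadic_cube j m)) f"
    "integrable (lebesgue_on (dyadic_cube j m)) (\<lambda>x. \<bar>f x\<bar> powr p)" and x: "x \<in> dyadic_cube j m"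
  shows "\<bar>dyE j f x\<bar> powr p * measure lebesgue (dyadic_cube j m) \<le> (\<integral>x. \<bar>f x\<bar> powr p \<partial>lebesgue_on (dyadic_cube j m))"
proof -
  let ?M = "lebesgue_on (dyadic_cube j m)"
  have c: "Q.E 0 f y = dyE j f x" if "y \<in> space ?M" for y
  proof -
    have "dyadic_cube_at j y = dyadic_cube_at j x"
      using that x by (simp add: dyadic_cube_at_eq mem_dyadic_cube)
    then show ?thesis using that E_dyadic[of y 0 f] by (simp add: dyE_def)
  qed
  have "\<bar>dyE j f x\<bar> powr p * measure lebesgue (dyadic_cube j m) = (\<integral>y. \<bar>dyE j f x\<bar> powr p \<partial>?M)"
    using measure_restrict_space[of "dyadic_cube j m" lebesgue "dyadic_cube j m"] by simp
  also have "\<dots> = (\<integral>y. \<bar>Q.E 0 f y\<bar> powr p \<partial>?M)"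
    by (intro Bochner_Integration.integral_cong refl) (simp add: c)
  also have "\<dots> \<le> (\<integral>x. \<bar>f x\<bar> powr p \<partial>?M)" by (rule Q.integral_E_powr_le[OF p f])
  finally show ?thesis .
qed

end

section \<open>Convergence of dyadic averages\<close>

text \<open>Taken with c = h x for the convergence of averages of continuous functions, and with c =
  0 to see that averages of a function bounded by B are bounded by B.\<close>

lemma dyE_close:
  fixes h :: "real ^ 'n \<Rightarrow> real"
  assumes h: "h \<in> borel_measurable lebesgue"
    and b: "\<And>y. y \<in> dyadic_cube_at k x \<Longrightarrow> \<bar>h y - c\<bar> \<le> e"
  shows "\<bar>dyE k h x - c\<bar> \<le> e"
proof -
  let ?C = "dyadic_cube_at k x"
  let ?M = "lebesgue_on ?C"
  have C: "?C \<in> lmeasurable" by (simp add: dyadic_cube_at_eq dyadic_cube_lmeasurable)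
  then have Cs: "?C \<in> sets lebesgue" by (rule fmeasurableD)
  interpret finite_measure ?M using C by (rule finite_measure_lebesgue_on)
  have "(0::real) < (2 powi (- k)) ^ CARD('n)" by simp
  also have "\<dots> \<le> measure lebesgue ?C" unfolding dyadic_cube_at_eq by (rule measure_dyadic_cube_ge)
  finally have pos: "0 < measure lebesgue ?C" .
  have hM: "h \<in> borel_measurable ?M" using h by (rule measurable_restrict_space1)
  have i: "integrable ?M h"
  proof (rule integrable_const_bound[OF _ hM])
    show "AE y in ?M. norm (h y) \<le> \<bar>c\<bar> + e"
      by (rule AE_I2) (use b in fastforce)
  qed
  have mC: "measure ?M ?C = measure lebesgue ?C" using Cs by (intro measure_restrict_space) auto
  have "(LINT y:?C|lebesgue. h y) = (\<integral>y. h y \<partial>?M)"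
    using Cs by (simp add: integral_restrict_space set_lebesgue_integral_def)
  also have "\<dots> = (\<integral>y. h y - c \<partial>?M) + c * measure lebesgue ?C"
    using i mC by simp
  finally have "dyE k h x - c = (\<integral>y. h y - c \<partial>?M) / measure lebesgue ?C"
    using pos by (simp add: dyE_def field_simps)
  also have "\<bar>\<dots>\<bar> \<le> (\<integral>y. e \<partial>?M) / measure lebesgue ?C"
  proof -
    have "\<bar>\<integral>y. h y - c \<partial>?M\<bar> \<le> (\<integral>y. \<bar>h y - c\<bar> \<partial>?M)" by (rule integral_abs_bound)
    also have "\<dots> \<le> (\<integral>y. e \<partial>?M)" using i b by (intro integral_mono) auto
    finally show ?thesis using pos by (simp add: divide_right_mono)
  qed
  also have "\<dots> = e" using pos mC by simp
  finally show ?thesis .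
qed

lemma dist_dyadic_cube_at:
  fixes x y :: "real ^ 'n"
  assumes "y \<in> dyadic_cube_at k x"
  shows "dist y x \<le> real CARD('n) * 2 powi (- k)"
proof -
  have "\<bar>(y - x) $ i\<bar> \<le> 2 powi (- k)" for i
  proof -
    have "x \<in> dyadic_cube_at k x" by (rule in_dyadic_cube_at)
    with assms show ?thesis
      unfolding dyadic_cube_at_def dyadic_cube_def by (auto simp: algebra_simps dest!: spec[of _ i])
  qed
  then have "(\<Sum>i\<in>UNIV. \<bar>(y - x) $ i\<bar>) \<le> (\<Sum>i\<in>(UNIV::'n set). 2 powi (- k))"
    by (intro sum_mono)
  then show ?thesis using norm_le_l1_cart[of "y - x"] by (simp add: dist_norm)
qed

lemma tendsto_dyE_continuous:
  fixes h :: "real ^ 'n \<Rightarrow> real"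
  assumes h: "continuous_on UNIV h"
  shows "(\<lambda>i. dyE (j + int i) h x) \<longlonglongrightarrow> h x"
proof (rule LIMSEQ_I)
  fix e :: real assume e: "0 < e"
  have hm: "h \<in> borel_measurable lebesgue"
    using borel_measurable_continuous_onI[OF h] by (simp add: measurable_completion)
  obtain d where d: "0 < d" "\<And>y. dist y x < d \<Longrightarrow> dist (h y) (h x) < e / 2"
    using h e unfolding continuous_on_iff by (metis UNIV_I half_gt_zero)
  \<comment> \<open>The diameter bound for cubes of generation j + i, written as a geometric
    sequence.\<close>
  have "(\<lambda>i. real CARD('n) * 2 powi (- j) * (1 / 2) ^ i) \<longlonglongrightarrow> real CARD('n) * 2 powi (- j) * 0"
    by (intro tendsto_intros LIMSEQ_power_zero) auto
  then have "\<forall>\<^sub>F i in sequentially. real CARD('n) * 2 powi (- j) * (1 / 2) ^ i < d"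
    using d(1) by (intro order_tendstoD) auto
  then obtain k where k: "\<And>i. k \<le> i \<Longrightarrow> real CARD('n) * 2 powi (- j) * (1 / 2) ^ i < d"
    by (auto simp: eventually_sequentially)
  have "norm (dyE (j + int i) h x - h x) < e" if "k \<le> i" for i
  proof -
    have "(2::real) powi (- (j + int i)) = 2 powi (- j) * 2 powi (- int i)"
      using power_int_add[of "2::real" "- j" "- int i"] by simp
    also have "(2::real) powi (- int i) = (1 / 2) ^ i"
      by (simp add: power_int_minus power_one_over inverse_eq_divide)
    finally have eq: "2 powi (- (j + int i)) = 2 powi (- j) * (1 / 2 :: real) ^ i" .
    have "\<bar>dyE (j + int i) h x - h x\<bar> \<le> e / 2"
    proof (rule dyE_close[OF hm])
      fix y assume "y \<in> dyadic_cube_at (j + int i) x"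
      then have "dist y x < d" using dist_dyadic_cube_at[of y "j + int i" x] k[OF that] unfolding eq by simp
      then show "\<bar>h y - h x\<bar> \<le> e / 2" using d(2)[of y] by (simp add: dist_real_def)
    qed
    then show ?thesis using e by simp
  qed
  then show "\<exists>k. \<forall>i\<ge>k. norm (dyE (j + int i) h x - h x) < e" by blast
qed

lemma cube_index_measurable: "cube_index k \<in> lebesgue \<rightarrow>\<^sub>M count_space UNIV"
  unfolding measurable_count_space_eq_countable[OF countableI_type]
proof (intro conjI ballI)
  fix m
  have "cube_index k -` {m} \<inter> space lebesgue = dyadic_cube k m"
    by (auto simp: mem_dyadic_cube)
  then show "cube_index k -` {m} \<inter> space lebesgue \<in> sets lebesgue"
    by (simp only: dyadic_cube_lebesgue)
qed simp

text \<open>The average factors through the cube label, a measurable map into a countable discrete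
  space.\<close>

lemma dyE_measurable [measurable]: "dyE k f \<in> borel_measurable lebesgue"
proof -
  have "(\<lambda>x. (\<lambda>m. (LINT y:dyadic_cube k m|lebesgue. f y) / measure lebesgue (dyadic_cube k m)) (cube_index k x))
    \<in> borel_measurable lebesgue"
    by (rule measurable_compose[OF cube_index_measurable]) simp
  then show ?thesis by (simp add: dyE_def[abs_def] dyadic_cube_at_eq)
qed

lemma dyD_measurable [measurable]: "dyD k f \<in> borel_measurable lebesgue"
  unfolding dyD_def[abs_def] by measurable

context
  fixes j :: int and m :: "int ^ 'n"
begin

interpretation Q: finite_filtration "lebesgue_on (dyadic_cube j m)" "\<lambda>i x. cube_index (j + int i) x"
  by (rule finite_filtration_dyadic_cube)

text \<open>Three layers: bounded continuous functions by pointwise convergence, bounded measurable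
  functions as a.e. limits of continuous ones, integrable functions as limits of their truncations.
  The last two are closure steps under dominated limits.\<close>

lemma tendsto_L1_dyE:
  assumes f: "f \<in> borel_measurable lebesgue" "integrable (lebesgue_on (dyadic_cube j m)) f"
  shows "(\<lambda>i. \<integral>x. \<bar>dyE (j + int i) f x - f x\<bar> \<partial>lebesgue_on (dyadic_cube j m)) \<longlonglongrightarrow> 0"
proof -
  let ?M = "lebesgue_on (dyadic_cube j m)"
  have lebM: "h \<in> borel_measurable ?M" if "h \<in> borel_measurable lebesgue" for h :: "real ^ 'n \<Rightarrow> real"
    using that by (rule measurable_restrict_space1)
  have bdd: "integrable ?M h" if "h \<in> borel_measurable lebesgue" "\<And>x. \<bar>h x\<bar> \<le> B" for h and B :: real
    using that by (intro Q.integrable_const_bound[where B=B] lebM) auto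
  have eq: "(\<integral>x. \<bar>dyE (j + int i) h x - h x\<bar> \<partial>?M) = (\<integral>x. \<bar>Q.E i h x - h x\<bar> \<partial>?M)" for i h
    by (intro Bochner_Integration.integral_cong refl) (simp add: E_dyadic)
  have cont: "(\<lambda>i. \<integral>x. \<bar>Q.E i h x - h x\<bar> \<partial>?M) \<longlonglongrightarrow> 0"
    if h: "continuous_on UNIV h" "\<And>x. \<bar>h x\<bar> \<le> B" for h and B :: real
  proof -
    have hm: "h \<in> borel_measurable lebesgue"
      using borel_measurable_continuous_onI[OF h(1)] by (simp add: measurable_completion)
    have "(\<lambda>i. \<integral>x. \<bar>dyE (j + int i) h x - h x\<bar> \<partial>?M) \<longlonglongrightarrow> (\<integral>x. 0 \<partial>?M)"
    proof (rule integral_dominated_convergence[where w="\<lambda>_. 2 * B"])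
      show "AE x in ?M. (\<lambda>i. \<bar>dyE (j + int i) h x - h x\<bar>) \<longlonglongrightarrow> 0"
      proof (rule AE_I2)
        fix x show "(\<lambda>i. \<bar>dyE (j + int i) h x - h x\<bar>) \<longlonglongrightarrow> 0"
          using tendsto_rabs[OF tendsto_diff[OF tendsto_dyE_continuous[OF h(1), of j x] tendsto_const[of "h x"]]] by simp
      qed
      show "AE x in ?M. norm \<bar>dyE (j + int i) h x - h x\<bar> \<le> 2 * B" for i
      proof (rule AE_I2)
        fix x
        have "\<bar>dyE (j + int i) h x - 0\<bar> \<le> B" by (rule dyE_close[OF hm]) (use h in simp)
        then show "norm \<bar>dyE (j + int i) h x - h x\<bar> \<le> 2 * B" using h(2)[of x] by simp
      qed
    qed (use hm in \<open>auto intro!: lebM\<close>)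
    then show ?thesis unfolding eq by simp
  qed
  have bounded: "(\<lambda>i. \<integral>x. \<bar>Q.E i h x - h x\<bar> \<partial>?M) \<longlonglongrightarrow> 0"
    if h: "h \<in> borel_measurable lebesgue" "\<And>x. \<bar>h x\<bar> \<le> B" for h and B :: real
  proof -
    have "h measurable_on UNIV"
      using h(1) by (intro lebesgue_measurable_imp_measurable_on) auto
    then obtain N g where N: "negligible N" and g: "\<And>n. continuous_on UNIV (g n)"
      and lim: "\<And>x. x \<notin> N \<Longrightarrow> (\<lambda>n. g n x) \<longlonglongrightarrow> h x"
      unfolding measurable_on_def by auto
    \<comment> \<open>Cutting off at B keeps the approximants continuous, supplies the dominating
      constant, and leaves the limit alone because |h| \<le> B.\<close>
    define s where "s = (\<lambda>n x. max (- B) (min B (g n x)))"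
    have B: "0 \<le> B" using h(2)[of undefined] by linarith
    have sc: "continuous_on UNIV (s n)" for n unfolding s_def by (intro continuous_on_max continuous_on_min continuous_on_const g)
    have sb: "\<bar>s n x\<bar> \<le> B" for n x unfolding s_def using B by auto
    have sm: "s n \<in> borel_measurable lebesgue" for n
      using borel_measurable_continuous_onI[OF sc] by (simp add: measurable_completion)
    have "AE x in lebesgue. x \<notin> N" using N by (simp add: AE_not_in negligible_iff_null_sets)
    then have "AE x in lebesgue. x \<in> dyadic_cube j m \<longrightarrow> x \<notin> N" by eventually_elim simp
    then have "AE x in ?M. x \<notin> N" by (subst AE_restrict_space_iff) simp_all
    then have AE: "AE x in ?M. (\<lambda>n. s n x) \<longlonglongrightarrow> h x"
    proof eventually_elim
      case (elim x)
      have "(\<lambda>n. s n x) \<longlonglongrightarrow> max (- B) (min B (h x))"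
        unfolding s_def by (intro tendsto_max tendsto_min tendsto_const lim elim)
      also have "max (- B) (min B (h x)) = h x" using h(2)[of x] by auto
      finally show ?case .
    qed
    show ?thesis
    proof (rule Q.tendsto_L1_E_dominated[where s=s and w="\<lambda>_. B"])
      show "integrable ?M (s n)" for n by (rule bdd[OF sm sb])
      show "(\<lambda>i. \<integral>x. \<bar>Q.E i (s n) x - s n x\<bar> \<partial>?M) \<longlonglongrightarrow> 0" for n by (rule cont[OF sc sb])
      show "h \<in> borel_measurable ?M" by (rule lebM[OF h(1)])
      show "AE x in ?M. (\<lambda>n. s n x) \<longlonglongrightarrow> h x" by (rule AE)
      show "AE x in ?M. \<bar>s n x\<bar> \<le> B" for n by (rule AE_I2) (rule sb)
    qed simp
  qed
  define s where "s = (\<lambda>n x. max (- real n) (min (real n) (f x)))"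
  have sm: "s n \<in> borel_measurable lebesgue" for n unfolding s_def using f(1) by measurable
  have sb: "\<bar>s n x\<bar> \<le> real n" for n x unfolding s_def by auto
  have lim: "(\<lambda>n. s n x) \<longlonglongrightarrow> f x" for x
  proof (rule tendsto_eventually)
    obtain n0 :: nat where n0: "\<bar>f x\<bar> \<le> real n0" using real_arch_simple by blast
    show "\<forall>\<^sub>F n in sequentially. s n x = f x"
      using eventually_ge_at_top[of n0] by eventually_elim (use n0 in \<open>auto simp: s_def\<close>)
  qed
  have "(\<lambda>i. \<integral>x. \<bar>Q.E i f x - f x\<bar> \<partial>?M) \<longlonglongrightarrow> 0"
  proof (rule Q.tendsto_L1_E_dominated[where s=s and w="\<lambda>x. \<bar>f x\<bar>"])
    show "integrable ?M (s n)" for n by (rule bdd[OF sm sb])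
    show "(\<lambda>i. \<integral>x. \<bar>Q.E i (s n) x - s n x\<bar> \<partial>?M) \<longlonglongrightarrow> 0" for n by (rule bounded[OF sm sb])
    show "f \<in> borel_measurable ?M" by (rule lebM[OF f(1)])
    show "integrable ?M (\<lambda>x. \<bar>f x\<bar>)" by (rule integrable_abs[OF f(2)])
    show "AE x in ?M. (\<lambda>n. s n x) \<longlonglongrightarrow> f x" by (rule AE_I2) (rule lim)
    show "AE x in ?M. \<bar>s n x\<bar> \<le> \<bar>f x\<bar>" for n by (rule AE_I2) (auto simp: s_def)
  qed
  then show ?thesis unfolding eq .
qed

end

text \<open>Fatou's lemma in the form used for each passage to the limit: growing windows of
  generations, averages converging a.e. on a cube, and cubes exhausting space.\<close>

lemma nn_integral_le_of_tendsto:
  fixes u :: "nat \<Rightarrow> 'a \<Rightarrow> ennreal"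
  assumes u: "\<And>n. u n \<in> borel_measurable M" and lim: "AE x in M. (\<lambda>n. u n x) \<longlonglongrightarrow> v x"
    and le: "\<And>n. (\<integral>\<^sup>+x. u n x \<partial>M) \<le> c"
  shows "(\<integral>\<^sup>+x. v x \<partial>M) \<le> c"
proof -
  have "(\<integral>\<^sup>+x. v x \<partial>M) = (\<integral>\<^sup>+x. liminf (\<lambda>n. u n x) \<partial>M)"
  proof (rule nn_integral_cong_AE)
    show "AE x in M. v x = liminf (\<lambda>n. u n x)"
      using lim by eventually_elim (simp add: lim_imp_Liminf)
  qed
  also have "\<dots> \<le> liminf (\<lambda>n. \<integral>\<^sup>+x. u n x \<partial>M)" by (intro nn_integral_liminf u)
  also have "\<dots> \<le> c" using le by (intro Liminf_le) auto
  finally show ?thesis .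
qed

text \<open>The cubes of one generation form a countable partition, and the measure with density w
  is countably additive. The constant c must not depend on the cube.\<close>

lemma nn_integral_le_of_cubes:
  fixes u v :: "real ^ 'n \<Rightarrow> ennreal"
  assumes u: "u \<in> borel_measurable lebesgue" and v: "v \<in> borel_measurable lebesgue"
    and le: "\<And>m. (\<integral>\<^sup>+x. u x \<partial>lebesgue_on (dyadic_cube j m)) \<le> c * (\<integral>\<^sup>+x. v x \<partial>lebesgue_on (dyadic_cube j m))"
  shows "(\<integral>\<^sup>+x. u x \<partial>lebesgue) \<le> c * (\<integral>\<^sup>+x. v x \<partial>lebesgue)"
proof -
  have split: "(\<integral>\<^sup>+x. w x \<partial>lebesgue) = (\<integral>\<^sup>+m. (\<integral>\<^sup>+x. w x \<partial>lebesgue_on (dyadic_cube j m)) \<partial>count_space UNIV)"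
    if w: "w \<in> borel_measurable lebesgue" for w :: "real ^ 'n \<Rightarrow> ennreal"
  proof -
    have cell: "emeasure (density lebesgue w) (dyadic_cube j m) = (\<integral>\<^sup>+x. w x \<partial>lebesgue_on (dyadic_cube j m))" for m
      using w by (simp add: emeasure_density nn_integral_restrict_space)
    have "(\<integral>\<^sup>+x. w x \<partial>lebesgue) = emeasure (density lebesgue w) (\<Union>m. dyadic_cube j m)"
    proof -
      have "(\<Union>m. dyadic_cube j m) = (UNIV :: (real ^ 'n) set)" by (auto simp: mem_dyadic_cube)
      then show ?thesis using w by (simp add: emeasure_density)
    qed
    also have "\<dots> = (\<integral>\<^sup>+m. emeasure (density lebesgue w) (dyadic_cube j m) \<partial>count_space UNIV)"
      by (intro emeasure_UN_countable) (auto simp: disjoint_family_on_def mem_dyadic_cube)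
    finally show ?thesis unfolding cell .
  qed
  have "(\<integral>\<^sup>+x. u x \<partial>lebesgue) \<le> (\<integral>\<^sup>+m. c * (\<integral>\<^sup>+x. v x \<partial>lebesgue_on (dyadic_cube j m)) \<partial>count_space UNIV)"
    unfolding split[OF u] by (intro nn_integral_mono le)
  also have "\<dots> = c * (\<integral>\<^sup>+x. v x \<partial>lebesgue)"
    unfolding split[OF v] by (intro nn_integral_cmult) auto
  finally show ?thesis .
qed

section \<open>The real square function on the whole space\<close>

lemma ennreal_powr_ennreal [simp]: "0 \<le> a \<Longrightarrow> ennreal_powr (ennreal a) s = ennreal (a powr s)"
  by (simp add: ennreal_powr_def)

lemma ennreal_powr_top [simp]: "ennreal_powr top s = top"
  by (simp add: ennreal_powr_def)

lemma ennreal_powr_powr: "ennreal_powr (ennreal_powr a s) t = ennreal_powr a (s * t)"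
  by (cases a) (auto simp: powr_powr)

lemma ennreal_powr_mono:
  assumes "a \<le> b" "0 \<le> s"
  shows "ennreal_powr a s \<le> ennreal_powr b s"
proof (cases b)
  case (real b')
  then obtain a' where "a = ennreal a'" "0 \<le> a'" "a' \<le> b'"
    using assms by (cases a) (auto simp: top_unique)
  then show ?thesis using real assms by (auto intro!: ennreal_leI powr_mono2)
qed simp

lemma ennreal_powr_add_le:
  assumes "0 \<le> s"
  shows "ennreal_powr (a + b) s \<le> ennreal (2 powr s) * (ennreal_powr a s + ennreal_powr b s)"
proof (cases "a = \<infinity> \<or> b = \<infinity>")
  case True
  then show ?thesis by (auto simp: ennreal_mult_top)
next
  case False
  then obtain a' b' where ab: "a = ennreal a'" "0 \<le> a'" "b = ennreal b'" "0 \<le> b'"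
    by (cases a; cases b) auto
  have "ennreal_powr (a + b) s = ennreal ((a' + b') powr s)"
    using ab by (simp flip: ennreal_plus)
  also have "\<dots> \<le> ennreal (2 powr s * (a' powr s + b' powr s))"
    using ab assms by (intro ennreal_leI powr_add_le) auto
  also have "\<dots> = ennreal (2 powr s) * (ennreal_powr a s + ennreal_powr b s)"
    using ab by (simp add: ennreal_mult)
  finally show ?thesis .
qed

lemma ennreal_powr_le_mult:
  assumes "a \<le> ennreal K * b" "0 < K" "0 < s"
  shows "ennreal_powr a s \<le> ennreal (K powr s) * ennreal_powr b s"
proof (cases b)
  case (real b')
  have "ennreal_powr a s \<le> ennreal_powr (ennreal (K * b')) s"
    using assms real by (intro ennreal_powr_mono) (auto simp: ennreal_mult)
  also have "\<dots> = ennreal (K powr s) * ennreal_powr b s"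
    using real assms by (subst ennreal_powr_ennreal) (auto simp: powr_mult ennreal_mult)
  finally show ?thesis .
next
  case top
  then show ?thesis using assms by (simp add: ennreal_mult_top)
qed

text \<open>The square sum may be infinite a priori, so the limit \<open>top\<close> is included;
  there a threshold l for the powers corresponds to l^(1/s) for the terms.\<close>

lemma tendsto_ennreal_powr:
  assumes a: "\<And>n. 0 \<le> a n" and lim: "(\<lambda>n. ennreal (a n)) \<longlonglongrightarrow> L" and s: "0 < s"
  shows "(\<lambda>n. ennreal (a n powr s)) \<longlonglongrightarrow> ennreal_powr L s"
proof (cases L)
  case (real b)
  then have "a \<longlonglongrightarrow> b" using lim a by (simp add: tendsto_ennreal_iff)
  then have "(\<lambda>n. a n powr s) \<longlonglongrightarrow> b powr s"
    using a s by (intro tendsto_powr' tendsto_const) auto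
  then show ?thesis using real by (auto intro!: tendsto_ennrealI)
next
  case top
  have "(\<lambda>n. ennreal (a n powr s)) \<longlonglongrightarrow> top"
    unfolding tendsto_top_iff_ennreal
  proof (intro allI impI)
    fix l :: real assume l: "0 \<le> l"
    have "\<forall>\<^sub>F n in sequentially. ennreal (l powr (1 / s)) < ennreal (a n)"
      using top by (intro order_tendstoD(1)[OF lim]) simp
    then show "\<forall>\<^sub>F n in sequentially. ennreal l < ennreal (a n powr s)"
    proof eventually_elim
      case (elim n)
      then have "l powr (1 / s) < a n" by (simp add: ennreal_less_iff)
      then have "(l powr (1 / s)) powr s < a n powr s" using s by (intro powr_less_mono2) auto
      then show ?case using l s by (simp add: powr_powr ennreal_less_iff)
    qed
  qed
  then show ?thesis using top by simp
qed

text \<open>A cube has finite measure and |f| \<le> 1 + |f|^p, so L^p functions are integrable on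
  it. The third bound is uniform over all cubes, which the decay of averages over large cubes relies
  on.\<close>

lemma integrable_on_cube:
  fixes f :: "real ^ 'n \<Rightarrow> 'b :: {banach, second_countable_topology}"
  assumes f: "f \<in> borel_measurable lebesgue" and p: "1 < p"
    and fin: "(\<integral>\<^sup>+x. ennreal (norm (f x) powr p) \<partial>lebesgue) < \<infinity>"
  shows "integrable (lebesgue_on (dyadic_cube j m)) f"
    and "integrable (lebesgue_on (dyadic_cube j m)) (\<lambda>x. norm (f x) powr p)"
    and "(\<integral>x. norm (f x) powr p \<partial>lebesgue_on (dyadic_cube j m))
      \<le> enn2real (\<integral>\<^sup>+x. ennreal (norm (f x) powr p) \<partial>lebesgue)"
proof -
  let ?M = "lebesgue_on (dyadic_cube j m)"
  interpret finite_measure ?M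
    using dyadic_cube_lmeasurable by (rule finite_measure_lebesgue_on)
  have fM: "f \<in> borel_measurable ?M" using f by (rule measurable_restrict_space1)
  have le: "(\<integral>\<^sup>+x. ennreal (norm (f x) powr p) \<partial>?M) \<le> (\<integral>\<^sup>+x. ennreal (norm (f x) powr p) \<partial>lebesgue)"
    by (subst nn_integral_restrict_space) (auto intro!: nn_integral_mono split: split_indicator)
  show i: "integrable ?M (\<lambda>x. norm (f x) powr p)"
    using le fin fM by (intro integrableI_bounded) auto
  show "integrable ?M f"
  proof (rule Bochner_Integration.integrable_bound[OF _ fM])
    show "integrable ?M (\<lambda>x. 1 + norm (f x) powr p)" using i by simp
    have "norm (f x) \<le> 1 + norm (f x) powr p" for x
    proof (cases "norm (f x) \<le> 1")
      case True
      then show ?thesis using powr_ge_zero[of "norm (f x)" p] by linarith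
    next
      case False
      then have "norm (f x) powr 1 \<le> norm (f x) powr p" using p by (intro powr_mono) auto
      then show ?thesis using False by simp
    qed
    then show "AE x in ?M. norm (f x) \<le> norm (1 + norm (f x) powr p)"
      by (intro AE_I2) (simp add: add_nonneg_nonneg)
  qed
  have "(\<integral>x. norm (f x) powr p \<partial>?M) = enn2real (\<integral>\<^sup>+x. ennreal (norm (f x) powr p) \<partial>?M)"
    by (rule integral_eq_nn_integral) (use fM in auto)
  also have "\<dots> \<le> enn2real (\<integral>\<^sup>+x. ennreal (norm (f x) powr p) \<partial>lebesgue)"
    using le fin by (intro enn2real_mono) auto
  finally show "(\<integral>x. norm (f x) powr p \<partial>?M) \<le> enn2real (\<integral>\<^sup>+x. ennreal (norm (f x) powr p) \<partial>lebesgue)" .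
qed

section \<open>Dyadic square sums over all generations\<close>

definition sq_sum :: "(real ^ 'n \<Rightarrow> real) \<Rightarrow> real ^ 'n \<Rightarrow> ennreal" where
  "sq_sum f x = (\<Sum>\<^sub>\<infinity>k\<in>UNIV. ennreal ((dyD k f x)\<^sup>2))"

lemma partial_le_sq_sum:
  assumes "finite F"
  shows "ennreal (\<Sum>k\<in>F. (dyD k f x)\<^sup>2) \<le> sq_sum f x"
proof -
  have "ennreal (\<Sum>k\<in>F. (dyD k f x)\<^sup>2) = (\<Sum>k\<in>F. ennreal ((dyD k f x)\<^sup>2))"
    by (simp add: sum_ennreal)
  also have "\<dots> \<le> sq_sum f x"
    unfolding sq_sum_def using assms by (subst nonneg_infsum_complete) (auto intro!: SUP_upper)
  finally show ?thesis .
qed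

text \<open>The window is -N + 1, ..., N, written as j + 1, ..., j + n with j = -N and n = 2 N to
  match the estimates on a cube of generation j.\<close>

lemma tendsto_sq_sum:
  "(\<lambda>N. ennreal (\<Sum>k\<in>{- int N + 1..- int N + int (2 * N)}. (dyD k f x)\<^sup>2)) \<longlonglongrightarrow> sq_sum f x"
proof -
  have "((\<lambda>k. ennreal ((dyD k f x)\<^sup>2)) has_sum sq_sum f x) UNIV"
    unfolding sq_sum_def by (intro has_sum_infsum nonneg_summable_on_complete) simp
  then have "(sum (\<lambda>k. ennreal ((dyD k f x)\<^sup>2)) \<longlongrightarrow> sq_sum f x) (finite_subsets_at_top UNIV)"
    by (simp add: has_sum_def)
  moreover have "filterlim (\<lambda>N. {- int N + 1..- int N + int (2 * N)}) (finite_subsets_at_top UNIV) sequentially"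
    unfolding filterlim_finite_subsets_at_top
  proof (intro allI impI)
    fix X :: "int set" assume "finite X \<and> X \<subseteq> UNIV"
    then obtain B where B: "\<And>k. k \<in> X \<Longrightarrow> \<bar>k\<bar> \<le> B"
      using finite_imageI[of X abs] Max_ge[of "abs ` X"] by blast
    show "\<forall>\<^sub>F N in sequentially. finite {- int N + 1..- int N + int (2 * N)} \<and>
        X \<subseteq> {- int N + 1..- int N + int (2 * N)} \<and> {- int N + 1..- int N + int (2 * N)} \<subseteq> UNIV"
      using eventually_gt_at_top[of "nat B"]
    proof eventually_elim
      case (elim N)
      have "k \<in> {- int N + 1..- int N + int (2 * N)}" if "k \<in> X" for k
        using B[OF that] elim by auto
      then show ?case by auto
    qed
  qed
  ultimately have "(\<lambda>N. sum (\<lambda>k. ennreal ((dyD k f x)\<^sup>2)) {- int N + 1..- int N + int (2 * N)}) \<longlonglongrightarrow> sq_sum f x"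
    by (rule filterlim_compose)
  then show ?thesis by (simp add: sum_ennreal)
qed

lemma tendsto_sq_sum_powr:
  assumes "0 < s"
  shows "(\<lambda>N. ennreal ((\<Sum>k\<in>{- int N + 1..- int N + int (2 * N)}. (dyD k f x)\<^sup>2) powr s)) \<longlonglongrightarrow> ennreal_powr (sq_sum f x) s"
  by (rule tendsto_ennreal_powr[OF _ tendsto_sq_sum assms]) (simp add: sum_nonneg)

lemma partial_sum_measurable:
  "(\<lambda>x. ennreal ((\<Sum>k\<in>F. (dyD k f x)\<^sup>2) powr s)) \<in> borel_measurable lebesgue"
  by measurable

lemma sq_sum_powr_measurable:
  assumes "0 < s"
  shows "(\<lambda>x. ennreal_powr (sq_sum f x) s) \<in> borel_measurable lebesgue"
  by (rule borel_measurable_LIMSEQ_order[OF tendsto_sq_sum_powr[OF assms] partial_sum_measurable])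

text \<open>For each N the cubes of generation -N are followed for 2 N steps. The constant depends
  neither on N nor on the cube, so the bound passes to the sum over cubes and then to the
  limit.\<close>

theorem nn_integral_sq_sum_le:
  fixes f :: "real ^ 'n \<Rightarrow> real"
  assumes f: "f \<in> borel_measurable lebesgue" and p: "1 < p"
    and fin: "(\<integral>\<^sup>+x. ennreal (\<bar>f x\<bar> powr p) \<partial>lebesgue) < \<infinity>"
  shows "(\<integral>\<^sup>+x. ennreal_powr (sq_sum f x) (p / 2) \<partial>lebesgue)
    \<le> ennreal (sq_const p) * (\<integral>\<^sup>+x. ennreal (\<bar>f x\<bar> powr p) \<partial>lebesgue)"
proof (rule nn_integral_le_of_tendsto)
  show "(\<lambda>x. ennreal ((\<Sum>k\<in>{- int N + 1..- int N + int (2 * N)}. (dyD k f x)\<^sup>2) powr (p / 2)))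
      \<in> borel_measurable lebesgue" for N
    by (rule partial_sum_measurable)
  show "AE x in lebesgue. (\<lambda>N. ennreal ((\<Sum>k\<in>{- int N + 1..- int N + int (2 * N)}. (dyD k f x)\<^sup>2) powr (p / 2)))
      \<longlonglongrightarrow> ennreal_powr (sq_sum f x) (p / 2)"
    by (rule AE_I2, rule tendsto_sq_sum_powr) (use p in simp)
  show "(\<integral>\<^sup>+x. ennreal ((\<Sum>k\<in>{- int N + 1..- int N + int (2 * N)}. (dyD k f x)\<^sup>2) powr (p / 2)) \<partial>lebesgue)
      \<le> ennreal (sq_const p) * (\<integral>\<^sup>+x. ennreal (\<bar>f x\<bar> powr p) \<partial>lebesgue)" for N
  proof (rule nn_integral_le_of_cubes[where j="- int N"])
    show "(\<integral>\<^sup>+x. ennreal ((\<Sum>k\<in>{- int N + 1..- int N + int (2 * N)}. (dyD k f x)\<^sup>2) powr (p / 2)) \<partial>lebesgue_on (dyadic_cube (- int N) m))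
      \<le> ennreal (sq_const p) * (\<integral>\<^sup>+x. ennreal (\<bar>f x\<bar> powr p) \<partial>lebesgue_on (dyadic_cube (- int N) m))" for m
      by (intro cube_square_function_le p integrable_on_cube(1)[OF f p]
          integrable_on_cube(2)[OF f p, unfolded real_norm_def]) (simp_all only: real_norm_def fin)
  qed (use f in measurable)
qed

lemma tendsto_dyE_0:
  fixes f :: "real ^ 'n \<Rightarrow> real"
  assumes f: "f \<in> borel_measurable lebesgue" and p: "1 < p"
    and fin: "(\<integral>\<^sup>+x. ennreal (\<bar>f x\<bar> powr p) \<partial>lebesgue) < \<infinity>"
  shows "(\<lambda>N. dyE (- int N) f x) \<longlonglongrightarrow> 0"
proof -
  define I where "I = enn2real (\<integral>\<^sup>+x. ennreal (\<bar>f x\<bar> powr p) \<partial>lebesgue)"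
  have I0: "0 \<le> I" by (simp add: I_def)
  have fin': "(\<integral>\<^sup>+x. ennreal (norm (f x) powr p) \<partial>lebesgue) < \<infinity>" using fin by simp
  note i = integrable_on_cube[OF f p fin', unfolded real_norm_def, folded I_def]
  have b: "\<bar>dyE (- int N) f x\<bar> \<le> (I * (1 / 2) ^ N) powr (1 / p)" for N
  proof -
    let ?Q = "dyadic_cube_at (- int N) x"
    \<comment> \<open>The dimension is at least 1, so a cube of side 2^N has volume at least
      2^N.\<close>
    have "(2::real) ^ N \<le> (2 powi int N) ^ CARD('n)"
      by (simp add: self_le_power)
    also have "\<dots> \<le> measure lebesgue ?Q"
      using measure_dyadic_cube_ge[of "- int N" "cube_index (- int N) x"] by (simp add: dyadic_cube_at_eq)
    finally have "\<bar>dyE (- int N) f x\<bar> powr p * 2 ^ N \<le> \<bar>dyE (- int N) f x\<bar> powr p * measure lebesgue ?Q"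
      by (intro mult_left_mono) auto
    also have "\<dots> \<le> (\<integral>x. \<bar>f x\<bar> powr p \<partial>lebesgue_on ?Q)"
      unfolding dyadic_cube_at_eq by (intro cube_average_powr_le p i) (simp add: mem_dyadic_cube)
    also have "\<dots> \<le> I" unfolding dyadic_cube_at_eq by (rule i)
    finally have "\<bar>dyE (- int N) f x\<bar> powr p \<le> I * (1 / 2) ^ N" by (simp add: field_simps)
    then have "(\<bar>dyE (- int N) f x\<bar> powr p) powr (1 / p) \<le> (I * (1 / 2) ^ N) powr (1 / p)"
      using p by (intro powr_mono2) auto
    then show ?thesis using p by (simp add: powr_powr)
  qed
  have "(\<lambda>N. (I * (1 / 2) ^ N) powr (1 / p)) \<longlonglongrightarrow> (I * 0) powr (1 / p)"
    using p I0 by (intro tendsto_powr' tendsto_mult tendsto_const LIMSEQ_power_zero) auto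
  then have "(\<lambda>N. (I * (1 / 2) ^ N) powr (1 / p)) \<longlonglongrightarrow> 0" by simp
  then show ?thesis by (rule Lim_null_comparison[rotated]) (use b in auto)
qed

theorem nn_integral_le_sq_sum:
  fixes f :: "real ^ 'n \<Rightarrow> real" and p p' :: real
  assumes f: "f \<in> borel_measurable lebesgue" and p: "1 < p" "1 < p'" "1 / p + 1 / p' = 1"
    and fin: "(\<integral>\<^sup>+x. ennreal (\<bar>f x\<bar> powr p) \<partial>lebesgue) < \<infinity>"
  shows "(\<integral>\<^sup>+x. ennreal (\<bar>f x\<bar> powr p) \<partial>lebesgue)
    \<le> ennreal (2 * (2 * sq_const p') powr (p / p')) * (\<integral>\<^sup>+x. ennreal_powr (sq_sum f x) (p / 2) \<partial>lebesgue)"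
proof -
  let ?C = "ennreal (2 * (2 * sq_const p') powr (p / p'))"
  have fin': "(\<integral>\<^sup>+x. ennreal (norm (f x) powr p) \<partial>lebesgue) < \<infinity>" using fin by simp
  note i = integrable_on_cube[OF f p(1) fin', unfolded real_norm_def]
  have pow: "(\<lambda>n. ennreal (\<bar>a n\<bar> powr p)) \<longlonglongrightarrow> ennreal (\<bar>t\<bar> powr p)" if "a \<longlonglongrightarrow> t" for a t
    using that p(1) by (intro tendsto_ennrealI tendsto_powr' tendsto_rabs tendsto_const) auto
  have cube: "(\<integral>\<^sup>+x. ennreal (\<bar>f x - dyE j f x\<bar> powr p) \<partial>lebesgue_on (dyadic_cube j m))
    \<le> ?C * (\<integral>\<^sup>+x. ennreal_powr (sq_sum f x) (p / 2) \<partial>lebesgue_on (dyadic_cube j m))" for j m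
  proof -
    let ?M = "lebesgue_on (dyadic_cube j m)"
    have lebM: "h \<in> borel_measurable ?M" if "h \<in> borel_measurable lebesgue" for h :: "real ^ 'n \<Rightarrow> real"
      using that by (rule measurable_restrict_space1)
    interpret Q: finite_filtration ?M "\<lambda>i x. cube_index (j + int i) x"
      by (rule finite_filtration_dyadic_cube)
    have iE: "integrable ?M (dyE (j + int n) f)" for n
    proof -
      have "integrable ?M (Q.E n f)" by (rule Q.integrable_adapted[OF Q.adapted_E[OF order_refl]])
      then show ?thesis
        by (subst (asm) Bochner_Integration.integrable_cong[OF refl E_dyadic]) auto
    qed
    \<comment> \<open>Convergence in L^1 gives convergence a.e. along a subsequence; as the bound
      below is the same for every index, a subsequence is enough for Fatou's lemma.\<close>
    have "\<exists>r. strict_mono r \<and> (AE x in ?M. (\<lambda>n. dyE (j + int (r n)) f x - f x) \<longlonglongrightarrow> 0)"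
    proof (rule tendsto_L1_AE_subseq)
      show "integrable ?M (\<lambda>x. dyE (j + int n) f x - f x)" for n using iE i(1) by simp
      show "(\<lambda>n. \<integral>x. norm (dyE (j + int n) f x - f x) \<partial>?M) \<longlonglongrightarrow> 0"
        unfolding real_norm_def by (rule tendsto_L1_dyE[OF f i(1)])
    qed
    then obtain r where AE: "AE x in ?M. (\<lambda>n. dyE (j + int (r n)) f x - f x) \<longlonglongrightarrow> 0" by blast
    show ?thesis
    proof (rule nn_integral_le_of_tendsto)
      show "(\<lambda>x. ennreal (\<bar>dyE (j + int (r n)) f x - dyE j f x\<bar> powr p)) \<in> borel_measurable ?M" for n
        using lebM[OF dyE_measurable, of "j + int (r n)" f] lebM[OF dyE_measurable, of j f] by measurable
      show "AE x in ?M. (\<lambda>n. ennreal (\<bar>dyE (j + int (r n)) f x - dyE j f x\<bar> powr p))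
          \<longlonglongrightarrow> ennreal (\<bar>f x - dyE j f x\<bar> powr p)"
        using AE
      proof eventually_elim
        case (elim x)
        then have "(\<lambda>n. dyE (j + int (r n)) f x) \<longlonglongrightarrow> f x" by (rule LIM_zero_cancel)
        then show ?case by (intro pow tendsto_diff tendsto_const)
      qed
      show "(\<integral>\<^sup>+x. ennreal (\<bar>dyE (j + int (r n)) f x - dyE j f x\<bar> powr p) \<partial>?M)
        \<le> ?C * (\<integral>\<^sup>+x. ennreal_powr (sq_sum f x) (p / 2) \<partial>?M)" for n
      proof -
        \<comment> \<open>Each finite window lies below the full sum, so the right-hand side no
          longer involves n.\<close>
        have "ennreal ((\<Sum>k\<in>{j + 1..j + int (r n)}. (dyD k f x)\<^sup>2) powr (p / 2)) \<le> ennreal_powr (sq_sum f x) (p / 2)" for x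
          using ennreal_powr_mono[OF partial_le_sq_sum[of "{j + 1..j + int (r n)}" f x], of "p / 2"] p(1)
          by (simp add: sum_nonneg)
        then have "?C * (\<integral>\<^sup>+x. ennreal ((\<Sum>k\<in>{j + 1..j + int (r n)}. (dyD k f x)\<^sup>2) powr (p / 2)) \<partial>?M)
          \<le> ?C * (\<integral>\<^sup>+x. ennreal_powr (sq_sum f x) (p / 2) \<partial>?M)"
          by (intro mult_left_mono nn_integral_mono) auto
        with cube_martingale_le[OF p i(1), where n="r n" and j=j and m=m] show ?thesis by (rule order_trans)
      qed
    qed
  qed
  \<comment> \<open>Now j = -N: the cube bounds are summed, and the subtracted average tends to 0 at
    every point.\<close>
  show ?thesis
  proof (rule nn_integral_le_of_tendsto)
    show "(\<lambda>x. ennreal (\<bar>f x - dyE (- int N) f x\<bar> powr p)) \<in> borel_measurable lebesgue" for N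
      using f by measurable
    show "AE x in lebesgue. (\<lambda>N. ennreal (\<bar>f x - dyE (- int N) f x\<bar> powr p)) \<longlonglongrightarrow> ennreal (\<bar>f x\<bar> powr p)"
    proof (rule AE_I2)
      fix x
      have "(\<lambda>N. f x - dyE (- int N) f x) \<longlonglongrightarrow> f x - 0"
        by (intro tendsto_diff tendsto_const tendsto_dyE_0[OF f p(1) fin])
      then show "(\<lambda>N. ennreal (\<bar>f x - dyE (- int N) f x\<bar> powr p)) \<longlonglongrightarrow> ennreal (\<bar>f x\<bar> powr p)"
        using pow by simp
    qed
    show "(\<integral>\<^sup>+x. ennreal (\<bar>f x - dyE (- int N) f x\<bar> powr p) \<partial>lebesgue)
      \<le> ?C * (\<integral>\<^sup>+x. ennreal_powr (sq_sum f x) (p / 2) \<partial>lebesgue)" for N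
    proof (rule nn_integral_le_of_cubes[OF _ _ cube])
      show "(\<lambda>x. ennreal (\<bar>f x - dyE (- int N) f x\<bar> powr p)) \<in> borel_measurable lebesgue"
        using f by measurable
      show "(\<lambda>x. ennreal_powr (sq_sum f x) (p / 2)) \<in> borel_measurable lebesgue"
        by (rule sq_sum_powr_measurable) (use p in simp)
    qed
  qed
qed

section \<open>Complex functions and the chirp\<close>

text \<open>Integrability is essential: a complex function that is not integrable has integral 0 by
  convention, although its real part may have a nonzero integral.\<close>

lemma dyadic_E_eq:
  fixes F :: "real ^ 'n \<Rightarrow> complex"
  assumes "\<And>m. integrable (lebesgue_on (dyadic_cube k m)) F"
  shows "Re (dyadic_E k F x) = dyE k (\<lambda>y. Re (F y)) x" "Im (dyadic_E k F x) = dyE k (\<lambda>y. Im (F y)) x"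
proof -
  let ?C = "dyadic_cube_at k x"
  have C: "?C \<in> sets lebesgue" by (simp add: dyadic_cube_at_eq)
  have i: "integrable (lebesgue_on ?C) F" unfolding dyadic_cube_at_eq by (rule assms)
  have set: "(LINT y:?C|lebesgue. h y) = (\<integral>y. h y \<partial>lebesgue_on ?C)"
    for h :: "real ^ 'n \<Rightarrow> 'b :: {banach, second_countable_topology}"
    using C by (simp add: integral_restrict_space set_lebesgue_integral_def)
  have "Re (dyadic_E k F x) = (\<integral>y. Re (F y) \<partial>lebesgue_on ?C) / measure lebesgue ?C"
    unfolding dyadic_E_def set using integral_Re[OF i] by (simp add: divide_inverse mult.commute)
  then show "Re (dyadic_E k F x) = dyE k (\<lambda>y. Re (F y)) x"
    unfolding dyE_def set .
  have "Im (dyadic_E k F x) = (\<integral>y. Im (F y) \<partial>lebesgue_on ?C) / measure lebesgue ?C"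
    unfolding dyadic_E_def set using integral_Im[OF i] by (simp add: divide_inverse mult.commute)
  then show "Im (dyadic_E k F x) = dyE k (\<lambda>y. Im (F y)) x"
    unfolding dyE_def set .
qed

lemma sq_sum_complex:
  fixes F :: "real ^ 'n \<Rightarrow> complex"
  assumes "\<And>k m. integrable (lebesgue_on (dyadic_cube k m)) F"
  shows "(\<Sum>\<^sub>\<infinity>k\<in>UNIV. ennreal ((cmod (dyadic_D k F x))\<^sup>2))
    = sq_sum (\<lambda>y. Re (F y)) x + sq_sum (\<lambda>y. Im (F y)) x"
proof -
  have "ennreal ((cmod (dyadic_D k F x))\<^sup>2)
    = ennreal ((dyD k (\<lambda>y. Re (F y)) x)\<^sup>2) + ennreal ((dyD k (\<lambda>y. Im (F y)) x)\<^sup>2)" for k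
    unfolding cmod_power2 dyadic_D_def dyD_def by (simp add: dyadic_E_eq assms ennreal_plus)
  then show ?thesis
    unfolding sq_sum_def by (simp add: infsum_add nonneg_summable_on_complete)
qed

lemma Lp_norm_square_function:
  "Lp_norm p (square_function T F) =
    ennreal_powr (\<integral>\<^sup>+x. ennreal_powr (\<Sum>\<^sub>\<infinity>k\<in>UNIV. ennreal ((cmod (T k F x))\<^sup>2)) (p / 2) \<partial>lebesgue) (1 / p)"
  by (simp add: Lp_norm_def square_function_def ennreal_powr_powr)

lemma ex_square_function_constant:
  fixes p :: real
  assumes p: "1 < p"
  shows "\<exists>c>0. \<forall>F :: real ^ 'n \<Rightarrow> complex. F \<in> Lp_space p \<longrightarrow>
    ennreal (1 / c) * cLp_norm p F \<le> Lp_norm p (S_dy_classical F) \<and>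
    Lp_norm p (S_dy_classical F) \<le> ennreal c * cLp_norm p F"
proof -
  define p' where "p' = p / (p - 1)"
  have p': "1 < p'" "1 / p + 1 / p' = 1" using p by (auto simp: p'_def field_simps)
  define A where "A = sq_const p"
  define B where "B = 2 * (2 * sq_const p') powr (p / p')"
  have A: "0 < A" using sq_const_pos[OF p] by (simp add: A_def)
  have B: "0 < B" using sq_const_pos[OF p'(1)] by (simp add: B_def)
  \<comment> \<open>2^(p/2) is the loss in splitting a p/2-th power of a sum, 2 counts real and
    imaginary part, and A + B exceeds both A and B, so that one K serves both directions.\<close>
  define K where "K = 2 powr (p / 2) * (2 * (A + B))"
  have K: "0 < K" using A B by (simp add: K_def)
  have KX: "ennreal (2 powr (p / 2)) * (ennreal (A + B) * X + ennreal (A + B) * X) = ennreal K * X" for X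
  proof -
    have "K = 2 powr (p / 2) * ((A + B) + (A + B))" by (simp add: K_def)
    also have "ennreal \<dots> = ennreal (2 powr (p / 2)) * (ennreal (A + B) + ennreal (A + B))"
      using A B by (subst ennreal_mult) (simp_all only: ennreal_plus powr_ge_zero add_nonneg_nonneg less_imp_le)
    finally show ?thesis by (simp only: distrib_right mult.assoc)
  qed
  define c where "c = K powr (1 / p)"
  have c: "0 < c" using K by (simp add: c_def)
  have "ennreal (1 / c) * cLp_norm p F \<le> Lp_norm p (S_dy_classical F) \<and>
    Lp_norm p (S_dy_classical F) \<le> ennreal c * cLp_norm p F" if F: "F \<in> Lp_space p" for F :: "real ^ 'n \<Rightarrow> complex"
  proof -
    define J where "J = (\<integral>\<^sup>+x. ennreal (cmod (F x) powr p) \<partial>lebesgue)"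
    define S where "S = (\<integral>\<^sup>+x. ennreal_powr (\<Sum>\<^sub>\<infinity>k\<in>UNIV. ennreal ((cmod (dyadic_D k F x))\<^sup>2)) (p / 2) \<partial>lebesgue)"
    define R where "R = (\<lambda>x. Re (F x))"
    define I where "I = (\<lambda>x. Im (F x))"
    have Fm: "F \<in> borel_measurable lebesgue" using F by (simp add: Lp_space_def)
    have Rm: "R \<in> borel_measurable lebesgue" and Im: "I \<in> borel_measurable lebesgue"
      unfolding R_def I_def using Fm by measurable
    have normF: "cLp_norm p F = ennreal_powr J (1 / p)" by (simp add: Lp_norm_def J_def)
    have normS: "Lp_norm p (S_dy_classical F) = ennreal_powr S (1 / p)"
      unfolding S_def by (rule Lp_norm_square_function)
    have J: "J < \<infinity>"
    proof (rule ccontr)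
      assume "\<not> J < \<infinity>"
      then have "J = top" by (simp add: less_top[symmetric])
      then show False using F normF by (simp add: Lp_space_def)
    qed
    have int: "integrable (lebesgue_on (dyadic_cube k m)) F" for k m
      by (rule integrable_on_cube(1)[OF Fm p]) (use J in \<open>simp add: J_def\<close>)
    define JR where "JR = (\<integral>\<^sup>+x. ennreal (\<bar>R x\<bar> powr p) \<partial>lebesgue)"
    define JI where "JI = (\<integral>\<^sup>+x. ennreal (\<bar>I x\<bar> powr p) \<partial>lebesgue)"
    define SR where "SR = (\<integral>\<^sup>+x. ennreal_powr (sq_sum R x) (p / 2) \<partial>lebesgue)"
    define SI where "SI = (\<integral>\<^sup>+x. ennreal_powr (sq_sum I x) (p / 2) \<partial>lebesgue)"
    have JRJ: "JR \<le> J" unfolding JR_def J_def R_def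
      using p abs_Re_le_cmod by (intro nn_integral_mono ennreal_leI powr_mono2) auto
    have JIJ: "JI \<le> J" unfolding JI_def J_def I_def
      using p abs_Im_le_cmod by (intro nn_integral_mono ennreal_leI powr_mono2) auto
    have JR: "JR < \<infinity>" and JI: "JI < \<infinity>" using JRJ JIJ J by auto
    have up: "SR \<le> ennreal A * JR" "SI \<le> ennreal A * JI"
      unfolding SR_def SI_def A_def JR_def JI_def
      using nn_integral_sq_sum_le[OF Rm p] nn_integral_sq_sum_le[OF Im p] JR JI by (simp_all add: JR_def JI_def)
    have low: "JR \<le> ennreal B * SR" "JI \<le> ennreal B * SI"
      unfolding SR_def SI_def B_def JR_def JI_def
      using nn_integral_le_sq_sum[OF Rm p p'] nn_integral_le_sq_sum[OF Im p p'] JR JI by (simp_all add: JR_def JI_def)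
    have S_eq: "S = (\<integral>\<^sup>+x. ennreal_powr (sq_sum R x + sq_sum I x) (p / 2) \<partial>lebesgue)"
      unfolding S_def R_def I_def by (simp add: sq_sum_complex int)
    have mR: "(\<lambda>x. ennreal_powr (sq_sum R x) (p / 2)) \<in> borel_measurable lebesgue"
      and mI: "(\<lambda>x. ennreal_powr (sq_sum I x) (p / 2)) \<in> borel_measurable lebesgue"
      by (rule sq_sum_powr_measurable, use p in simp)+
    have "S \<le> (\<integral>\<^sup>+x. ennreal (2 powr (p / 2)) * (ennreal_powr (sq_sum R x) (p / 2) + ennreal_powr (sq_sum I x) (p / 2)) \<partial>lebesgue)"
      unfolding S_eq using p by (intro nn_integral_mono ennreal_powr_add_le) auto
    also have "\<dots> = ennreal (2 powr (p / 2)) * (SR + SI)"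
      unfolding SR_def SI_def using mR mI by (simp add: nn_integral_cmult nn_integral_add)
    also have "\<dots> \<le> ennreal (2 powr (p / 2)) * (ennreal (A + B) * J + ennreal (A + B) * J)"
    proof (intro mult_left_mono add_mono)
      show "SR \<le> ennreal (A + B) * J" using A B by (intro order_trans[OF up(1)] mult_mono JRJ ennreal_leI) auto
      show "SI \<le> ennreal (A + B) * J" using A B by (intro order_trans[OF up(2)] mult_mono JIJ ennreal_leI) auto
    qed auto
    also have "\<dots> = ennreal K * J"
      by (rule KX)
    finally have SJ: "S \<le> ennreal K * J" .
    have "J \<le> (\<integral>\<^sup>+x. ennreal (2 powr (p / 2)) * (ennreal (\<bar>R x\<bar> powr p) + ennreal (\<bar>I x\<bar> powr p)) \<partial>lebesgue)"
      unfolding J_def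
    proof (intro nn_integral_mono)
      fix x
      have "cmod (F x) powr p = ((R x)\<^sup>2 + (I x)\<^sup>2) powr (p / 2)"
        using abs_powr_eq_square_powr[of "cmod (F x)" p] unfolding R_def I_def cmod_power2[symmetric] by simp
      also have "\<dots> \<le> 2 powr (p / 2) * (\<bar>R x\<bar> powr p + \<bar>I x\<bar> powr p)"
        unfolding abs_powr_eq_square_powr using p by (intro powr_add_le) auto
      finally have "ennreal (cmod (F x) powr p) \<le> ennreal (2 powr (p / 2) * (\<bar>R x\<bar> powr p + \<bar>I x\<bar> powr p))"
        by (rule ennreal_leI)
      also have "\<dots> = ennreal (2 powr (p / 2)) * (ennreal (\<bar>R x\<bar> powr p) + ennreal (\<bar>I x\<bar> powr p))"
        by (simp add: ennreal_mult)
      finally show "ennreal (cmod (F x) powr p) \<le> \<dots>" .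
    qed
    also have "\<dots> = ennreal (2 powr (p / 2)) * (JR + JI)"
      unfolding JR_def JI_def using Rm Im by (simp add: nn_integral_cmult nn_integral_add)
    also have "\<dots> \<le> ennreal (2 powr (p / 2)) * (ennreal (A + B) * S + ennreal (A + B) * S)"
    proof (intro mult_left_mono add_mono)
      \<comment> \<open>The square sums of the real and of the imaginary part are each a summand of
        the complex one.\<close>
      have "SR \<le> S" "SI \<le> S" unfolding SR_def SI_def S_eq
        using p by (auto intro!: nn_integral_mono ennreal_powr_mono)
      then show "JR \<le> ennreal (A + B) * S" "JI \<le> ennreal (A + B) * S"
        using A B by (auto intro!: order_trans[OF low(1)] order_trans[OF low(2)] mult_mono ennreal_leI)
    qed auto
    also have "\<dots> = ennreal K * S"
      by (rule KX)
    finally have JS: "J \<le> ennreal K * S" .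
    have 1: "Lp_norm p (S_dy_classical F) \<le> ennreal c * cLp_norm p F"
      unfolding normS normF c_def using SJ K p by (intro ennreal_powr_le_mult) auto
    have "cLp_norm p F \<le> ennreal c * Lp_norm p (S_dy_classical F)"
      unfolding normS normF c_def using JS K p by (intro ennreal_powr_le_mult) auto
    then have "ennreal (1 / c) * cLp_norm p F \<le> ennreal (1 / c) * (ennreal c * Lp_norm p (S_dy_classical F))"
      by (intro mult_left_mono) auto
    also have "\<dots> = Lp_norm p (S_dy_classical F)"
    proof -
      have "ennreal (1 / c) * ennreal c = 1" using c by (subst ennreal_mult[symmetric]) auto
      then show ?thesis by (simp only: mult.assoc[symmetric] mult_1_left)
    qed
    finally show ?thesis using 1 by blast
  qed
  then show ?thesis using c by blast
qed

section \<open>Transfer through multiplication by the chirp\<close>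

lemma cmod_chirp_mult [simp]: "cmod (chirp_mult \<alpha> f x) = cmod (f x)"
  by (simp add: chirp_mult_def norm_mult)

lemma cmod_twisted_D: "cmod (twisted_D \<alpha> k f x) = cmod (dyadic_D k (chirp_mult \<alpha> f) x)"
  by (simp add: twisted_D_def chirp_mult_inv_def norm_mult)

lemma chirp_mult_Lp_space:
  assumes "f \<in> Lp_space p"
  shows "chirp_mult \<alpha> f \<in> Lp_space p"
proof -
  have "continuous_on UNIV (\<lambda>x :: real ^ 'n. exp (\<i> * of_real (pi * (norm x)\<^sup>2 * cot \<alpha>)) :: complex)"
    by (intro continuous_intros)
  then have "(\<lambda>x :: real ^ 'n. exp (\<i> * of_real (pi * (norm x)\<^sup>2 * cot \<alpha>)) :: complex) \<in> borel_measurable lebesgue"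
    by (simp add: measurable_completion borel_measurable_continuous_onI)
  moreover have "f \<in> borel_measurable lebesgue" using assms by (simp add: Lp_space_def)
  ultimately have "chirp_mult \<alpha> f \<in> borel_measurable lebesgue"
    unfolding chirp_mult_def[abs_def] by (rule borel_measurable_times)
  then show ?thesis using assms by (simp add: Lp_space_def)
qed

theorem theorem7p5:
  fixes p :: real
  assumes "1 < p"
  shows "(\<exists>c::real>0. \<forall>\<alpha>::real. (\<forall>j::int. \<alpha> \<noteq> of_int j * pi) \<longrightarrow>
            (\<forall>f :: real ^ 'n \<Rightarrow> complex. f \<in> Lp_space p \<longrightarrow>
               ennreal (1 / c) * cLp_norm p f \<le> Lp_norm p (S_dy \<alpha> f) \<and>
               Lp_norm p (S_dy \<alpha> f) \<le> ennreal c * cLp_norm p f))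
       \<and> (\<forall>c::real>0.
            (\<forall>f :: real ^ 'n \<Rightarrow> complex. f \<in> Lp_space p \<longrightarrow>
               ennreal (1 / c) * cLp_norm p f \<le> Lp_norm p (S_dy_classical f) \<and>
               Lp_norm p (S_dy_classical f) \<le> ennreal c * cLp_norm p f) \<longrightarrow>
            (\<forall>\<alpha>::real. (\<forall>j::int. \<alpha> \<noteq> of_int j * pi) \<longrightarrow>
              (\<forall>f :: real ^ 'n \<Rightarrow> complex. f \<in> Lp_space p \<longrightarrow>
                 ennreal (1 / c) * cLp_norm p f \<le> Lp_norm p (S_dy \<alpha> f) \<and>
                 Lp_norm p (S_dy \<alpha> f) \<le> ennreal c * cLp_norm p f)))"
proof -
  have S: "Lp_norm p (S_dy \<alpha> f) = Lp_norm p (S_dy_classical (chirp_mult \<alpha> f))"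
    for \<alpha> and f :: "real ^ 'n \<Rightarrow> complex"
    by (simp add: Lp_norm_square_function cmod_twisted_D)
  \<comment> \<open>The classical inequalities are used at \<open>chirp_mult \<alpha> f\<close>,
    whose norm is that of f. Hence c carries over unchanged and for all \<alpha> at once, which
    yields both conjuncts.\<close>
  have twist: "ennreal (1 / c) * cLp_norm p f \<le> Lp_norm p (S_dy \<alpha> f) \<and>
      Lp_norm p (S_dy \<alpha> f) \<le> ennreal c * cLp_norm p f"
    if c: "\<forall>f :: real ^ 'n \<Rightarrow> complex. f \<in> Lp_space p \<longrightarrow>
               ennreal (1 / c) * cLp_norm p f \<le> Lp_norm p (S_dy_classical f) \<and>
               Lp_norm p (S_dy_classical f) \<le> ennreal c * cLp_norm p f"
      and f: "f \<in> Lp_space p" for c \<alpha> and f :: "real ^ 'n \<Rightarrow> complex"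
    using c[rule_format, OF chirp_mult_Lp_space[OF f, of \<alpha>]] by (simp only: S cmod_chirp_mult)
  obtain c :: real where "0 < c" and c: "\<forall>f :: real ^ 'n \<Rightarrow> complex. f \<in> Lp_space p \<longrightarrow>
               ennreal (1 / c) * cLp_norm p f \<le> Lp_norm p (S_dy_classical f) \<and>
               Lp_norm p (S_dy_classical f) \<le> ennreal c * cLp_norm p f"
    using ex_square_function_constant[OF assms, where 'n='n] by auto
  show ?thesis
  proof (rule conjI)
    show "\<exists>c::real>0. \<forall>\<alpha>::real. (\<forall>j::int. \<alpha> \<noteq> of_int j * pi) \<longrightarrow>
            (\<forall>f :: real ^ 'n \<Rightarrow> complex. f \<in> Lp_space p \<longrightarrow>
               ennreal (1 / c) * cLp_norm p f \<le> Lp_norm p (S_dy \<alpha> f) \<and>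
               Lp_norm p (S_dy \<alpha> f) \<le> ennreal c * cLp_norm p f)"
      by (rule exI[of _ c], intro conjI[OF \<open>0 < c\<close>] allI impI) (rule twist[OF c])
  qed (intro allI impI, rule twist)
qed

end
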